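(* Let $G$ be a group, $A=\bigoplus_{g\in G}A_g$ an epsilon-strongly $G$-graded ring, $R=A_1$, and let $n$ be a positive integer. The following assertions are equivalent: (i) $\operatorname{M}_n(A)$ is a partial crossed product; (ii) $\operatorname{M}_n(A)$ is an epsilon-crossed product; (iii) there is a map $\nu:G\to I_u(\operatorname{M}_n(R))$ such that $\operatorname{M}_n(A_g)\simeq {}_{\mathrm{id}}(\operatorname{M}_n(R)1_{\nu(g)})_{\nu(g)}$ as $\operatorname{M}_n(R)$-bimodules, for all $g\in G$; (iv) there is a map $\kappa:G\to H(\operatorname{M}_n(A))$, where $H(\operatorname{M}_n(A))$ is the set of non-zero homogeneous elements of $\operatorname{M}_n(A)$, such that $\kappa(g)\in\operatorname{M}_n(A_g)$ and $\operatorname{M}_n(R)\kappa(g)=\operatorname{M}_n(A_g)=\kappa(g)\operatorname{M}_n(R)$ for all $g\in G$.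
   Context: Rings are associative and unital. For subsets $X,Y$ of a ring, $XY$ is the set of finite sums of products $xy$. A $G$-graded unital ring $B=\bigoplus_{g\in G}B_g$ (so $B_gB_h\subseteq B_{gh}$) is epsilon-strongly graded if for every $g\in G$ there is $\epsilon_g\in B_gB_{g^{-1}}$ with $\epsilon_gb=b=b\epsilon_{g^{-1}}$ for all $b\in B_g$; $\epsilon_g$ is then unique. The matrix ring $\operatorname{M}_n(A)$ is $G$-graded with components $\operatorname{M}_n(A)_g=\operatorname{M}_n(A_g)$, and it is epsilon-strongly graded (with elements $\epsilon_gI_n$) when $A$ is. An epsilon-strongly graded ring $B$ is an epsilon-crossed product if for every $g\in G$ there is an epsilon-invertible element $a_g\in B_g$, i.e. there is $b_{g^{-1}}\in B_{g^{-1}}$ with $a_gb_{g^{-1}}=\epsilon_g$ and $b_{g^{-1}}a_g=\epsilon_{g^{-1}}$. $H(B)$ denotes the set of non-zero homogeneous elements of a $G$-graded ring $B$. For a ring $S$, $I_u(S)$ is the set of ring isomorphisms $\theta:S1_{\theta^{-1}}\to S1_\theta$ between unital ideals of $S$, where $1_{\theta^{-1}},1_\theta$ are the central idempotents of $S$ generating the domain and the image. For $\theta\in I_u(S)$, ${}_{\mathrm{id}}(S1_\theta)_\theta$ is the $S$-bimodule $S1_\theta$ with its usual left action and right action $m\cdot a=m\,\theta(a1_{\theta^{-1}})$. A unital twisted partial action of $G$ on a ring $S$ is a triple $(\{D_g\}_{g\in G},\{\alpha_g\}_{g\in G},\{\omega_{g,h}\}_{g,h\in G})$, where $D_g$ is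 an ideal of $S$ generated by a (possibly zero) central idempotent $1_g$, $\alpha_g:D_{g^{-1}}\to D_g$ is a ring isomorphism, and $\omega_{g,h}$ is a unit of the ring $D_gD_{gh}$, such that for all $g,h,l\in G$: $D_1=S$ and $\alpha_1=\mathrm{id}_S$; $\alpha_g(D_{g^{-1}}D_h)=D_gD_{gh}$; $\alpha_g\circ\alpha_h(t)=\omega_{g,h}\alpha_{gh}(t)\omega_{g,h}^{-1}$ for $t\in D_{h^{-1}}D_{(gh)^{-1}}$; $\omega_{1,g}=\omega_{g,1}=1_g$; $\alpha_g(\omega_{h,l}1_{g^{-1}})\omega_{g,hl}=\omega_{g,h}\omega_{gh,l}$. The associated partial crossed product is $S\star_{\alpha,\omega}G=\bigoplus_{g\in G}D_g\delta_g$ with multiplication $(a_g\delta_g)(b_h\delta_h)=a_g\alpha_g(b_h1_{g^{-1}})\omega_{g,h}\delta_{gh}$, graded by $(S\star_{\alpha,\omega}G)_g=D_g\delta_g$. A $G$-graded ring "is a partial crossed product" if it is isomorphic as a graded ring to such an $S\star_{\alpha,\omega}G$.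
   Formalization: In (iv), κ(g) may also be zero; with κ(g) required non-zero, (iv) is shown equivalent to the rest only when every A_g is non-zero, since otherwise it fails (e.g. a trivially graded field). In (i), S is taken on the underlying type of M_n(A), which loses nothing up to isomorphism. *)

theory Defs
  imports
    "HOL-Algebra.Ideal_Product"
    "HOL-Algebra.QuotRing"
    "Jordan_Normal_Form.Matrix"
begin

text \<open>
  Rings are HOL-Algebra rings, so the zero ring is allowed. For subsets \<open>X\<close>, \<open>Y\<close> of a ring \<open>B\<close>,
  the set of finite sums of products \<open>xy\<close> is \<^const>\<open>ideal_prod\<close>, whose definition makes sense for
  arbitrary subsets. It only forms non-empty sums; this makes no difference as soon as one
  factor contains \<open>0\<close> and the other one is non-empty, which holds throughout.
\<close>


section \<open>Graded rings\<close>

locale graded_ring = group G + ring B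
  for G :: "('g, 'k) monoid_scheme" and B :: "('b, 'm) ring_scheme"
    and Bc :: "'g \<Rightarrow> 'b set" +
  assumes comp_subgroup: "g \<in> carrier G \<Longrightarrow> additive_subgroup (Bc g) B"
    and direct_sum: "b \<in> carrier B \<Longrightarrow>
      \<exists>!c. c \<in> (\<Pi>\<^sub>E g\<in>carrier G. Bc g) \<and> finite {g \<in> carrier G. c g \<noteq> \<zero>\<^bsub>B\<^esub>} \<and>
           b = (\<Oplus>\<^bsub>B\<^esub>g\<in>{g \<in> carrier G. c g \<noteq> \<zero>\<^bsub>B\<^esub>}. c g)"
    and comp_mult: "\<lbrakk>g \<in> carrier G; h \<in> carrier G; x \<in> Bc g; y \<in> Bc h\<rbrakk> \<Longrightarrow>
      x \<otimes>\<^bsub>B\<^esub> y \<in> Bc (g \<otimes>\<^bsub>G\<^esub> h)"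

text \<open>
  A map \<open>\<kappa>\<close> from \<open>G\<close> into the non-zero homogeneous elements with \<open>\<kappa>(g) \<in> B\<^sub>g\<close> for all \<open>g\<close> can only
  exist if every component is non-zero. Epsilon-strongly graded rings may have zero components.
\<close>

definition nonzero_homogeneous ::
    "('g, 'k) monoid_scheme \<Rightarrow> ('b, 'm) ring_scheme \<Rightarrow> ('g \<Rightarrow> 'b set) \<Rightarrow> 'b set" where
  "nonzero_homogeneous G B Bc = (\<Union>g\<in>carrier G. Bc g) - {\<zero>\<^bsub>B\<^esub>}"

definition graded_iso ::
    "('g, 'k) monoid_scheme \<Rightarrow> ('b, 'm) ring_scheme \<Rightarrow> ('g \<Rightarrow> 'b set) \<Rightarrow>
     ('c, 'l) ring_scheme \<Rightarrow> ('g \<Rightarrow> 'c set) \<Rightarrow> ('b \<Rightarrow> 'c) set" where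
  "graded_iso G B Bc C Cc =
     {\<phi> \<in> ring_iso B C. \<forall>g\<in>carrier G. \<phi> ` Bc g = Cc g}"


section \<open>Epsilon-strongly graded rings and epsilon-crossed products\<close>

definition epsilon_family ::
    "('g, 'k) monoid_scheme \<Rightarrow> ('b, 'm) ring_scheme \<Rightarrow> ('g \<Rightarrow> 'b set) \<Rightarrow> ('g \<Rightarrow> 'b) \<Rightarrow> bool" where
  "epsilon_family G B Bc \<epsilon> \<longleftrightarrow>
     (\<forall>g\<in>carrier G. \<epsilon> g \<in> ideal_prod B (Bc g) (Bc (inv\<^bsub>G\<^esub> g)) \<and>
        (\<forall>b\<in>Bc g. \<epsilon> g \<otimes>\<^bsub>B\<^esub> b = b \<and> b \<otimes>\<^bsub>B\<^esub> \<epsilon> (inv\<^bsub>G\<^esub> g) = b))"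

definition epsilon_strongly_graded ::
    "('g, 'k) monoid_scheme \<Rightarrow> ('b, 'm) ring_scheme \<Rightarrow> ('g \<Rightarrow> 'b set) \<Rightarrow> bool" where
  "epsilon_strongly_graded G B Bc \<longleftrightarrow>
     graded_ring G B Bc \<and> (\<exists>\<epsilon>. epsilon_family G B Bc \<epsilon>)"

text \<open>The family \<open>\<epsilon>\<close> is unique on the group, so the quantifier over it below is harmless.\<close>

definition epsilon_crossed_product ::
    "('g, 'k) monoid_scheme \<Rightarrow> ('b, 'm) ring_scheme \<Rightarrow> ('g \<Rightarrow> 'b set) \<Rightarrow> bool" where
  "epsilon_crossed_product G B Bc \<longleftrightarrow>
     graded_ring G B Bc \<and>
     (\<exists>\<epsilon>. epsilon_family G B Bc \<epsilon> \<and>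
        (\<forall>g\<in>carrier G. \<exists>a\<in>Bc g. \<exists>b\<in>Bc (inv\<^bsub>G\<^esub> g).
           a \<otimes>\<^bsub>B\<^esub> b = \<epsilon> g \<and> b \<otimes>\<^bsub>B\<^esub> a = \<epsilon> (inv\<^bsub>G\<^esub> g)))"


section \<open>Unital ideals and the bimodules they define\<close>

definition central_idempotent :: "('s, 'm) ring_scheme \<Rightarrow> 's \<Rightarrow> bool" where
  "central_idempotent S e \<longleftrightarrow>
     e \<in> carrier S \<and> e \<otimes>\<^bsub>S\<^esub> e = e \<and> (\<forall>s\<in>carrier S. e \<otimes>\<^bsub>S\<^esub> s = s \<otimes>\<^bsub>S\<^esub> e)"

text \<open>
  For a central idempotent \<open>e\<close>, the two-sided ideal generated by \<open>e\<close> is \<open>Se\<close>, that is,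
  \<^const>\<open>cgenideal\<close>. It is a ring with identity \<open>e\<close>.
\<close>

definition unital_ideal_ring :: "('s, 'm) ring_scheme \<Rightarrow> 's \<Rightarrow> ('s, 'm) ring_scheme" where
  "unital_ideal_ring S e = S\<lparr>carrier := PIdl\<^bsub>S\<^esub> e, one := e\<rparr>"

text \<open>
  An element \<open>\<theta>\<close> of \<open>I\<^sub>u(S)\<close> is given as the triple \<open>(d, e, \<theta>)\<close> with \<open>d = 1\<^bsub>\<theta>\<^sup>-\<^sup>1\<^esub>\<close> and
  \<open>e = 1\<^bsub>\<theta>\<^esub>\<close>, which are determined by the domain and the image of \<open>\<theta>\<close>.
\<close>

definition Iu :: "('s, 'm) ring_scheme \<Rightarrow> ('s \<times> 's \<times> ('s \<Rightarrow> 's)) set" where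
  "Iu S = {(d, e, \<theta>). central_idempotent S d \<and> central_idempotent S e \<and>
     \<theta> \<in> ring_iso (unital_ideal_ring S d) (unital_ideal_ring S e) \<and>
     \<theta> \<in> extensional (PIdl\<^bsub>S\<^esub> d)}"

record ('s, 'b) bimodule = "'b partial_object" +
  badd :: "'b \<Rightarrow> 'b \<Rightarrow> 'b"
  lact :: "'s \<Rightarrow> 'b \<Rightarrow> 'b"
  ract :: "'b \<Rightarrow> 's \<Rightarrow> 'b"

definition bimodule_iso ::
    "('s, 'm) ring_scheme \<Rightarrow> ('s, 'b, 'k) bimodule_scheme \<Rightarrow> ('s, 'c, 'l) bimodule_scheme \<Rightarrow>
     ('b \<Rightarrow> 'c) set" where
  "bimodule_iso S M N = {\<phi>. bij_betw \<phi> (carrier M) (carrier N) \<and>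
     (\<forall>x\<in>carrier M. \<forall>y\<in>carrier M. \<phi> (badd M x y) = badd N (\<phi> x) (\<phi> y)) \<and>
     (\<forall>s\<in>carrier S. \<forall>x\<in>carrier M.
        \<phi> (lact M s x) = lact N s (\<phi> x) \<and> \<phi> (ract M x s) = ract N (\<phi> x) s)}"

definition sub_bimodule :: "('b, 'm) ring_scheme \<Rightarrow> 'b set \<Rightarrow> ('b, 'b) bimodule" where
  "sub_bimodule B V =
     \<lparr>carrier = V, badd = (\<lambda>x y. x \<oplus>\<^bsub>B\<^esub> y), lact = (\<lambda>x y. x \<otimes>\<^bsub>B\<^esub> y), ract = (\<lambda>x y. x \<otimes>\<^bsub>B\<^esub> y)\<rparr>"

definition twisted_bimodule ::
    "('s, 'm) ring_scheme \<Rightarrow> 's \<times> 's \<times> ('s \<Rightarrow> 's) \<Rightarrow> ('s, 's) bimodule" where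
  "twisted_bimodule S = (\<lambda>(d, e, \<theta>).
     \<lparr>carrier = PIdl\<^bsub>S\<^esub> e, badd = (\<lambda>x y. x \<oplus>\<^bsub>S\<^esub> y), lact = (\<lambda>x y. x \<otimes>\<^bsub>S\<^esub> y),
      ract = (\<lambda>m a. m \<otimes>\<^bsub>S\<^esub> \<theta> (a \<otimes>\<^bsub>S\<^esub> d))\<rparr>)"


section \<open>Unital twisted partial actions and partial crossed products\<close>

text \<open>
  A unital twisted partial action is given by the central idempotents \<open>u g = 1\<^sub>g\<close>, the
  isomorphisms \<open>\<alpha> g\<close> and the units \<open>\<omega> g h\<close>; the ideal \<open>D\<^sub>g\<close> is \<open>S1\<^sub>g\<close>. The values of \<open>\<alpha> g\<close>
  outside its domain \<open>S1\<^sub>h\<close>, with \<open>h\<close> the inverse of \<open>g\<close>, are irrelevant.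
\<close>

text \<open>For central idempotents \<open>d\<close> and \<open>e\<close>, the ring \<open>(Sd)(Se)\<close> has identity \<open>de\<close>.\<close>

definition prod_ideal_ring :: "('s, 'm) ring_scheme \<Rightarrow> 's \<Rightarrow> 's \<Rightarrow> ('s, 'm) ring_scheme" where
  "prod_ideal_ring S d e =
     S\<lparr>carrier := ideal_prod S (PIdl\<^bsub>S\<^esub> d) (PIdl\<^bsub>S\<^esub> e), one := d \<otimes>\<^bsub>S\<^esub> e\<rparr>"

locale unital_twisted_partial_action = group G + S: ring S
  for G :: "('g, 'k) monoid_scheme" and S :: "('s, 'm) ring_scheme"
    and u :: "'g \<Rightarrow> 's" and \<alpha> :: "'g \<Rightarrow> 's \<Rightarrow> 's" and \<omega> :: "'g \<Rightarrow> 'g \<Rightarrow> 's" +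
  assumes u_central: "g \<in> carrier G \<Longrightarrow> central_idempotent S (u g)"
    and \<alpha>_iso: "g \<in> carrier G \<Longrightarrow>
      \<alpha> g \<in> ring_iso (unital_ideal_ring S (u (inv\<^bsub>G\<^esub> g))) (unital_ideal_ring S (u g))"
    and \<omega>_unit: "\<lbrakk>g \<in> carrier G; h \<in> carrier G\<rbrakk> \<Longrightarrow>
      \<omega> g h \<in> Units (prod_ideal_ring S (u g) (u (g \<otimes>\<^bsub>G\<^esub> h)))"
    and D_one: "PIdl\<^bsub>S\<^esub> (u \<one>\<^bsub>G\<^esub>) = carrier S"
    and \<alpha>_one: "s \<in> carrier S \<Longrightarrow> \<alpha> \<one>\<^bsub>G\<^esub> s = s"
    and \<alpha>_image: "\<lbrakk>g \<in> carrier G; h \<in> carrier G\<rbrakk> \<Longrightarrow>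
      \<alpha> g ` ideal_prod S (PIdl\<^bsub>S\<^esub> (u (inv\<^bsub>G\<^esub> g))) (PIdl\<^bsub>S\<^esub> (u h)) =
        ideal_prod S (PIdl\<^bsub>S\<^esub> (u g)) (PIdl\<^bsub>S\<^esub> (u (g \<otimes>\<^bsub>G\<^esub> h)))"
    and \<alpha>_comp: "\<lbrakk>g \<in> carrier G; h \<in> carrier G;
        t \<in> ideal_prod S (PIdl\<^bsub>S\<^esub> (u (inv\<^bsub>G\<^esub> h))) (PIdl\<^bsub>S\<^esub> (u (inv\<^bsub>G\<^esub> (g \<otimes>\<^bsub>G\<^esub> h))))\<rbrakk> \<Longrightarrow>
      \<alpha> g (\<alpha> h t) =
        \<omega> g h \<otimes>\<^bsub>S\<^esub> \<alpha> (g \<otimes>\<^bsub>G\<^esub> h) t \<otimes>\<^bsub>S\<^esub>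
          inv\<^bsub>prod_ideal_ring S (u g) (u (g \<otimes>\<^bsub>G\<^esub> h))\<^esub> (\<omega> g h)"
    and \<omega>_one: "g \<in> carrier G \<Longrightarrow> \<omega> \<one>\<^bsub>G\<^esub> g = u g \<and> \<omega> g \<one>\<^bsub>G\<^esub> = u g"
    and \<omega>_cocycle: "\<lbrakk>g \<in> carrier G; h \<in> carrier G; l \<in> carrier G\<rbrakk> \<Longrightarrow>
      \<alpha> g (\<omega> h l \<otimes>\<^bsub>S\<^esub> u (inv\<^bsub>G\<^esub> g)) \<otimes>\<^bsub>S\<^esub> \<omega> g (h \<otimes>\<^bsub>G\<^esub> l) =
        \<omega> g h \<otimes>\<^bsub>S\<^esub> \<omega> (g \<otimes>\<^bsub>G\<^esub> h) l"

text \<open>A formal sum of terms \<open>a\<^sub>g \<delta>\<^sub>g\<close> is the finitely supported function \<open>g \<mapsto> a\<^sub>g\<close> on \<open>G\<close>.\<close>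

definition partial_crossed_product ::
    "('g, 'k) monoid_scheme \<Rightarrow> ('s, 'm) ring_scheme \<Rightarrow> ('g \<Rightarrow> 's) \<Rightarrow> ('g \<Rightarrow> 's \<Rightarrow> 's) \<Rightarrow>
     ('g \<Rightarrow> 'g \<Rightarrow> 's) \<Rightarrow> ('g \<Rightarrow> 's) ring" where
  "partial_crossed_product G S u \<alpha> \<omega> =
     \<lparr>carrier = {a \<in> (\<Pi>\<^sub>E g\<in>carrier G. PIdl\<^bsub>S\<^esub> (u g)). finite {g \<in> carrier G. a g \<noteq> \<zero>\<^bsub>S\<^esub>}},
      monoid.mult = (\<lambda>a b. \<lambda>k\<in>carrier G.
        finsum S (\<lambda>(g, h). a g \<otimes>\<^bsub>S\<^esub> \<alpha> g (b h \<otimes>\<^bsub>S\<^esub> u (inv\<^bsub>G\<^esub> g)) \<otimes>\<^bsub>S\<^esub> \<omega> g h)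
          {(g, h). g \<in> carrier G \<and> h \<in> carrier G \<and>
             a g \<noteq> \<zero>\<^bsub>S\<^esub> \<and> b h \<noteq> \<zero>\<^bsub>S\<^esub> \<and> g \<otimes>\<^bsub>G\<^esub> h = k}),
      one = (\<lambda>g\<in>carrier G. if g = \<one>\<^bsub>G\<^esub> then \<one>\<^bsub>S\<^esub> else \<zero>\<^bsub>S\<^esub>),
      zero = (\<lambda>g\<in>carrier G. \<zero>\<^bsub>S\<^esub>),
      add = (\<lambda>a b. \<lambda>g\<in>carrier G. a g \<oplus>\<^bsub>S\<^esub> b g)\<rparr>"

definition partial_crossed_product_comp ::
    "('g, 'k) monoid_scheme \<Rightarrow> ('s, 'm) ring_scheme \<Rightarrow> ('g \<Rightarrow> 's) \<Rightarrow> ('g \<Rightarrow> 's \<Rightarrow> 's) \<Rightarrow>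
     ('g \<Rightarrow> 'g \<Rightarrow> 's) \<Rightarrow> 'g \<Rightarrow> ('g \<Rightarrow> 's) set" where
  "partial_crossed_product_comp G S u \<alpha> \<omega> g =
     {a \<in> carrier (partial_crossed_product G S u \<alpha> \<omega>). \<forall>h\<in>carrier G. h \<noteq> g \<longrightarrow> a h = \<zero>\<^bsub>S\<^esub>}"

text \<open>
  The coefficient ring \<open>S\<close> has its elements in the type \<open>'b\<close> of elements of \<open>B\<close>. This is no
  restriction: a graded isomorphism identifies \<open>S\<close> with the component of \<open>B\<close> of degree \<open>1\<close>.
\<close>

definition is_partial_crossed_product ::
    "('g, 'k) monoid_scheme \<Rightarrow> ('b, 'm) ring_scheme \<Rightarrow> ('g \<Rightarrow> 'b set) \<Rightarrow> bool" where
  "is_partial_crossed_product G B Bc \<longleftrightarrow>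
     (\<exists>(S :: 'b ring) u \<alpha> \<omega>. unital_twisted_partial_action G S u \<alpha> \<omega> \<and>
        graded_iso G B Bc (partial_crossed_product G S u \<alpha> \<omega>)
          (partial_crossed_product_comp G S u \<alpha> \<omega>) \<noteq> {})"


section \<open>Matrix rings\<close>

definition mat_set :: "nat \<Rightarrow> 'a set \<Rightarrow> 'a mat set" where
  "mat_set n V = {M \<in> carrier_mat n n. \<forall>i<n. \<forall>j<n. M $$ (i, j) \<in> V}"

text \<open>
  The library's ring of matrices takes its entries from a type class; here the entries lie in
  the carrier of a ring.
\<close>

definition matrix_ring :: "nat \<Rightarrow> ('a, 'm) ring_scheme \<Rightarrow> 'a mat ring" where
  "matrix_ring n A =
     \<lparr>carrier = mat_set n (carrier A),
      monoid.mult = (\<lambda>M N. mat n n (\<lambda>(i, j). \<Oplus>\<^bsub>A\<^esub>k\<in>{..<n}. M $$ (i, k) \<otimes>\<^bsub>A\<^esub> N $$ (k, j))),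
      one = mat n n (\<lambda>(i, j). if i = j then \<one>\<^bsub>A\<^esub> else \<zero>\<^bsub>A\<^esub>),
      zero = mat n n (\<lambda>_. \<zero>\<^bsub>A\<^esub>),
      add = (\<lambda>M N. mat n n (\<lambda>(i, j). M $$ (i, j) \<oplus>\<^bsub>A\<^esub> N $$ (i, j)))\<rparr>"

end

(*
  The generator kappa(g) of M_n(A_g), the element of M_n(A_g) corresponding to the identity of the
  twisted bimodule, and the element 1_g delta_g of a partial crossed product are all
  epsilon-invertible homogeneous elements. Given such elements a_g with inverses b_g, the partial
  action is r |-> a_g r b_g, the twist is a_g a_h b_(gh), and x |-> x b_g identifies the component of
  degree g with the ideal generated by epsilon_g. Nothing here is specific to matrices: the argument
  applies to every epsilon-strongly graded ring B, and M_n(A) is one with elements epsilon_g I_n.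
*)
theory Submission
  imports Defs
begin

section \<open>Homogeneous parts in a graded ring\<close>

text \<open>The obstacle is that the elements \<epsilon> are central only in the component of degree
  one. Past a homogeneous \<open>x\<close> of degree \<open>g\<close> they change their index:
  \<open>x \<otimes> \<epsilon> h = \<epsilon> (g \<star> h) \<otimes> x\<close>. This rule brings
  products of the chosen elements into a form with all \<epsilon>'s on the left. The axioms of a
  twisted partial action, the inverse of the twist and the multiplicativity of the graded
  isomorphism are then comparisons of such forms. Assertions (i) and (ii) imply each other directly;
  (ii), (iii) and (iv) are joined by a cycle, so that the two-sided generation in (iv) has to
  produce inverses only once.\<close>

lemma (in abelian_monoid) finsum_swap:
  assumes "finite I" "finite J" "\<And>i j. \<lbrakk>i \<in> I; j \<in> J\<rbrakk> \<Longrightarrow> f i j \<in> carrier G"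
  shows "(\<Oplus>i\<in>I. \<Oplus>j\<in>J. f i j) = (\<Oplus>j\<in>J. \<Oplus>i\<in>I. f i j)"
  using assms(1,3)
proof (induction I rule: finite_induct)
  case empty
  then show ?case by simp
next
  case (insert x F)
  have "(\<Oplus>i\<in>insert x F. \<Oplus>j\<in>J. f i j) = (\<Oplus>j\<in>J. f x j) \<oplus> (\<Oplus>j\<in>J. \<Oplus>i\<in>F. f i j)"
    using insert by (subst finsum_insert) (auto intro!: finsum_closed)
  also have "\<dots> = (\<Oplus>j\<in>J. f x j \<oplus> (\<Oplus>i\<in>F. f i j))"
    using insert by (subst finsum_addf) (auto intro!: finsum_closed)
  also have "\<dots> = (\<Oplus>j\<in>J. \<Oplus>i\<in>insert x F. f i j)"
    using insert by (intro finsum_cong') (auto intro!: finsum_closed)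
  finally show ?case .
qed

lemma (in abelian_monoid) finsum_Times:
  assumes "finite I" "finite J" "\<And>i j. \<lbrakk>i \<in> I; j \<in> J\<rbrakk> \<Longrightarrow> f i j \<in> carrier G"
  shows "(\<Oplus>i\<in>I. \<Oplus>j\<in>J. f i j) = (\<Oplus>p\<in>I \<times> J. f (fst p) (snd p))"
  using assms(1,3)
proof (induction I rule: finite_induct)
  case empty
  then show ?case by simp
next
  case (insert x F)
  have "(\<Oplus>p\<in>Pair x ` J. f (fst p) (snd p)) = (\<Oplus>j\<in>J. f x j)"
    using insert.prems by (subst finsum_reindex) (auto simp: inj_on_def)
  moreover have "insert x F \<times> J = Pair x ` J \<union> F \<times> J"
    by auto
  moreover have "(\<Oplus>p\<in>Pair x ` J \<union> F \<times> J. f (fst p) (snd p)) =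
      (\<Oplus>p\<in>Pair x ` J. f (fst p) (snd p)) \<oplus> (\<Oplus>p\<in>F \<times> J. f (fst p) (snd p))"
    using insert assms(2) by (intro finsum_Un_disjoint) auto
  moreover have "(\<Oplus>i\<in>insert x F. \<Oplus>j\<in>J. f i j) = (\<Oplus>j\<in>J. f x j) \<oplus> (\<Oplus>i\<in>F. \<Oplus>j\<in>J. f i j)"
    using insert by (subst finsum_insert) (auto intro!: finsum_closed)
  ultimately show ?case
    using insert by simp
qed

lemma (in abelian_monoid) additive_finsum:
  assumes "\<And>x y. \<lbrakk>x \<in> carrier G; y \<in> carrier G\<rbrakk> \<Longrightarrow> h (x \<oplus> y) = h x \<oplus> h y"
    and "h \<zero> = \<zero>" and "h \<in> carrier G \<rightarrow> carrier G"
    and "finite I" "f \<in> I \<rightarrow> carrier G"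
  shows "h (\<Oplus>i\<in>I. f i) = (\<Oplus>i\<in>I. h (f i))"
  using assms(4,5)
proof (induction I rule: finite_induct)
  case (insert x F)
  then show ?case
    using assms(3) by (subst (1 2) finsum_insert) (auto simp: assms(1) Pi_iff finsum_closed)
qed (simp add: assms(2))

text \<open>A property of finite sums of products is proved by taking for \<open>V\<close> the set
  of elements that have it. Zero does not occur among the closure conditions because
  \<open>ideal_prod\<close> forms non-empty sums.\<close>

lemma (in ring) ideal_prod_memb:
  assumes "z \<in> ideal_prod R X Y" "\<And>x y. \<lbrakk>x \<in> X; y \<in> Y\<rbrakk> \<Longrightarrow> x \<otimes> y \<in> V"
    "\<And>v w. \<lbrakk>v \<in> V; w \<in> V\<rbrakk> \<Longrightarrow> v \<oplus> w \<in> V"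
  shows "z \<in> V"
  using assms(1) by induction (auto intro: assms(2,3))

section \<open>Calculus of homogeneous components\<close>

locale graded = G: group G + graded_ring G B Bc
  for G :: "('g, 'k) monoid_scheme" and B (structure) and Bc :: "'g \<Rightarrow> 'b set"
begin

abbreviation gmult (infixl \<open>\<star>\<close> 70) where "g \<star> h \<equiv> g \<otimes>\<^bsub>G\<^esub> h"
abbreviation ginv (\<open>_\<acute>\<close> [1000] 1000) where "g\<acute> \<equiv> inv\<^bsub>G\<^esub> g"
abbreviation gone (\<open>\<e>\<close>) where "\<e> \<equiv> \<one>\<^bsub>G\<^esub>"

lemma comp_carrier: "\<lbrakk>x \<in> Bc g; g \<in> carrier G\<rbrakk> \<Longrightarrow> x \<in> carrier B"
  by (rule subsetD[OF additive_subgroup.a_subset[OF comp_subgroup]])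

lemma comp_zero: "g \<in> carrier G \<Longrightarrow> \<zero> \<in> Bc g"
  using additive_subgroup.zero_closed[OF comp_subgroup] .

lemma comp_add: "\<lbrakk>x \<in> Bc g; y \<in> Bc g; g \<in> carrier G\<rbrakk> \<Longrightarrow> x \<oplus> y \<in> Bc g"
  using additive_subgroup.a_closed[OF comp_subgroup] .

lemma comp_neg: "\<lbrakk>x \<in> Bc g; g \<in> carrier G\<rbrakk> \<Longrightarrow> \<ominus> x \<in> Bc g"
  by (rule additive_subgroup.a_inv_closed[OF comp_subgroup])

lemma comp_mult': "\<lbrakk>x \<in> Bc g; y \<in> Bc h; g \<in> carrier G; h \<in> carrier G; k = g \<star> h\<rbrakk> \<Longrightarrow> x \<otimes> y \<in> Bc k"
  using comp_mult by blast

lemma comp_finsum: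
  assumes "g \<in> carrier G" "\<And>i. i \<in> I \<Longrightarrow> f i \<in> Bc g"
  shows "(\<Oplus>i\<in>I. f i) \<in> Bc g"
  using assms(2)
proof (induction I rule: infinite_finite_induct)
  case (insert x F)
  then show ?case
    using assms(1) by (subst finsum_insert) (auto intro: comp_carrier comp_add)
qed (use assms(1) comp_zero in auto)

text \<open>Well defined for \<open>b\<close> in the carrier by \<open>direct_sum\<close>. The
  family is then extensional on \<open>carrier G\<close>, so that agreement in all degrees of
  \<open>G\<close> is equality of functions.\<close>

definition part :: "'b \<Rightarrow> 'g \<Rightarrow> 'b" where
  "part b = (THE c. c \<in> (\<Pi>\<^sub>E g\<in>carrier G. Bc g) \<and> finite {g \<in> carrier G. c g \<noteq> \<zero>} \<and>
           b = (\<Oplus>g\<in>{g \<in> carrier G. c g \<noteq> \<zero>}. c g))"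

abbreviation supp :: "'b \<Rightarrow> 'g set" where
  "supp x \<equiv> {g \<in> carrier G. part x g \<noteq> \<zero>}"

lemma part_props:
  assumes "b \<in> carrier B"
  shows "part b \<in> (\<Pi>\<^sub>E g\<in>carrier G. Bc g)" "finite (supp b)" "b = (\<Oplus>g\<in>supp b. part b g)"
  using theI'[OF direct_sum[OF assms]] unfolding part_def[symmetric] by blast+

lemma part_closed: "\<lbrakk>b \<in> carrier B; g \<in> carrier G\<rbrakk> \<Longrightarrow> part b g \<in> Bc g"
  using part_props(1) by blast

lemma part_carrier [simp]: "\<lbrakk>b \<in> carrier B; g \<in> carrier G\<rbrakk> \<Longrightarrow> part b g \<in> carrier B"
  using part_closed comp_carrier by blast

lemma sum_parts:
  assumes "b \<in> carrier B" "finite F" "F \<subseteq> carrier G" "supp b \<subseteq> F"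
  shows "(\<Oplus>g\<in>F. part b g) = b"
proof -
  have "(\<Oplus>g\<in>supp b. part b g) = (\<Oplus>g\<in>F. part b g)"
    using assms by (intro add.finprod_mono_neutral_cong_left) auto
  then show ?thesis
    using part_props(3)[OF assms(1)] by simp
qed

lemma part_finsum_eq:
  assumes "finite F" "F \<subseteq> carrier G" "\<And>g. g \<in> F \<Longrightarrow> c g \<in> Bc g" and h: "h \<in> carrier G"
  shows "part (\<Oplus>g\<in>F. c g) h = (if h \<in> F then c h else \<zero>)"
proof -
  \<comment> \<open>Uniqueness in \<open>direct_sum\<close> speaks of families on all of
    \<open>G\<close>, so \<open>c\<close> is padded by zero. The support of \<open>d\<close> may be
    smaller than \<open>F\<close>, since some \<open>c g\<close> can vanish.\<close>
  define d where "d = (\<lambda>g\<in>carrier G. if g \<in> F then c g else \<zero>)"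
  let ?x = "\<Oplus>g\<in>F. c g"
  have c: "c g \<in> carrier B" if "g \<in> F" for g
    using that assms comp_carrier by blast
  then have x: "?x \<in> carrier B"
    by (intro finsum_closed) auto
  have d: "d \<in> (\<Pi>\<^sub>E g\<in>carrier G. Bc g)"
    using assms comp_zero by (auto simp: d_def)
  have sub: "{g \<in> carrier G. d g \<noteq> \<zero>} \<subseteq> F"
    by (auto simp: d_def split: if_splits)
  have "?x = (\<Oplus>g\<in>{g \<in> carrier G. d g \<noteq> \<zero>}. d g)"
    using sub assms(1,2) c by (intro add.finprod_mono_neutral_cong_right) (auto simp: d_def split: if_splits)
  with d finite_subset[OF sub assms(1)] have "part ?x = d"
    unfolding part_def by (intro the1_equality[OF direct_sum[OF x]]) blast
  then show ?thesis
    using h by (auto simp: d_def fun_eq_iff)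
qed

lemma part_homogeneous:
  assumes "x \<in> Bc g" "g \<in> carrier G" "h \<in> carrier G"
  shows "part x h = (if h = g then x else \<zero>)"
  using part_finsum_eq[of "{g}" "\<lambda>_. x" h] assms comp_carrier[of x g] by auto

lemma part_zero: "h \<in> carrier G \<Longrightarrow> part \<zero> h = \<zero>"
  using part_finsum_eq[of "{}" "\<lambda>_. \<zero>" h] by auto

lemma part_add:
  assumes "x \<in> carrier B" "y \<in> carrier B" "h \<in> carrier G"
  shows "part (x \<oplus> y) h = part x h \<oplus> part y h"
proof -
  \<comment> \<open>A common finite index set for both expansions; \<open>h\<close> is included so
    that the formula for the parts of a sum applies in degree \<open>h\<close> without a case
    distinction.\<close>
  let ?F = "insert h (supp x \<union> supp y)"
  have fin: "finite ?F" "?F \<subseteq> carrier G"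
    using assms part_props(2) by auto
  have "x \<oplus> y = (\<Oplus>g\<in>?F. part x g) \<oplus> (\<Oplus>g\<in>?F. part y g)"
    using assms fin by (subst (1 2) sum_parts) auto
  also have "\<dots> = (\<Oplus>g\<in>?F. part x g \<oplus> part y g)"
    using assms fin by (intro finsum_addf[symmetric]) auto
  finally have "part (x \<oplus> y) h = part (\<Oplus>g\<in>?F. part x g \<oplus> part y g) h"
    by simp
  also have "\<dots> = part x h \<oplus> part y h"
    using fin assms by (subst part_finsum_eq) (auto intro!: comp_add part_closed)
  finally show ?thesis .
qed

lemma part_finsum:
  assumes "finite I" "f \<in> I \<rightarrow> carrier B" "h \<in> carrier G"
  shows "part (\<Oplus>i\<in>I. f i) h = (\<Oplus>i\<in>I. part (f i) h)"
  using additive_finsum[of "\<lambda>x. part x h" I f] assms part_add part_zero by auto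

lemma eq_if_parts_eq:
  assumes "x \<in> carrier B" "y \<in> carrier B" "\<And>g. g \<in> carrier G \<Longrightarrow> part x g = part y g"
  shows "x = y"
proof -
  have "part x = part y"
    using assms part_props(1) by (intro PiE_ext[of _ "carrier G" Bc]) auto
  then show ?thesis
    using part_props(3)[OF assms(1)] part_props(3)[OF assms(2)] by simp
qed

lemma mult_finsum:
  assumes "finite X" "finite Y" "f \<in> X \<rightarrow> carrier B" "f' \<in> Y \<rightarrow> carrier B"
  shows "(\<Oplus>g\<in>X. f g) \<otimes> (\<Oplus>h\<in>Y. f' h) = (\<Oplus>p\<in>X \<times> Y. f (fst p) \<otimes> f' (snd p))"
proof -
  have "(\<Oplus>g\<in>X. f g) \<otimes> (\<Oplus>h\<in>Y. f' h) = (\<Oplus>g\<in>X. f g \<otimes> (\<Oplus>h\<in>Y. f' h))"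
    using assms by (intro finsum_ldistr finsum_closed) auto
  also have "\<dots> = (\<Oplus>g\<in>X. \<Oplus>h\<in>Y. f g \<otimes> f' h)"
    using assms by (intro finsum_cong' finsum_rdistr) (auto intro!: finsum_closed)
  also have "\<dots> = (\<Oplus>p\<in>X \<times> Y. f (fst p) \<otimes> f' (snd p))"
    using assms by (intro finsum_Times) auto
  finally show ?thesis .
qed

text \<open>The index set is written as in the multiplication of
  \<open>partial_crossed_product\<close>, so that the two products can be compared term by
  term.\<close>

lemma part_mult:
  assumes x: "x \<in> carrier B" and y: "y \<in> carrier B" and k: "k \<in> carrier G"
  shows "part (x \<otimes> y) k =
    (\<Oplus>p\<in>{(g, h). g \<in> carrier G \<and> h \<in> carrier G \<and> part x g \<noteq> \<zero> \<and> part y h \<noteq> \<zero> \<and> g \<star> h = k}.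
      part x (fst p) \<otimes> part y (snd p))" (is "_ = (\<Oplus>p\<in>?P. ?f p)")
proof -
  let ?Q = "supp x \<times> supp y"
  have fin: "finite ?Q"
    using x y part_props(2) by blast
  have "x \<otimes> y = (\<Oplus>g\<in>supp x. part x g) \<otimes> (\<Oplus>h\<in>supp y. part y h)"
    using part_props(3) x y by simp
  also have "\<dots> = (\<Oplus>p\<in>?Q. ?f p)"
    using x y part_props(2) by (intro mult_finsum) auto
  finally have "part (x \<otimes> y) k = (\<Oplus>p\<in>?Q. part (?f p) k)"
    using part_finsum[OF fin, of ?f k] k x y by (simp add: Pi_iff mem_Times_iff)
  also have "\<dots> = (\<Oplus>p\<in>?P. ?f p)"
  proof (rule add.finprod_mono_neutral_cong_right)
    \<comment> \<open>A pair contributes in degree \<open>k\<close> only if its degrees multiply to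
      \<open>k\<close>; all other pairs of the two supports drop out.\<close>
    have *: "part (?f p) k = (if k = fst p \<star> snd p then ?f p else \<zero>)"
      if "fst p \<in> carrier G" "snd p \<in> carrier G" for p
      using that x y k by (intro part_homogeneous comp_mult part_closed) auto
    show "part (?f p) k = ?f p" if "p \<in> ?P" for p
      using that * by (auto simp: case_prod_beta)
    show "part (?f p) k = \<zero>" if "p \<in> ?Q - ?P" for p
      using that * by (auto simp: case_prod_beta split: if_splits)
  qed (use fin x y k in \<open>auto intro!: part_carrier\<close>)
  finally show ?thesis .
qed

text \<open>For homogeneous \<open>x\<close>, comparing the parts of degree \<open>deg x\<close> in \<open>1x = x\<close> shows that
  \<open>1\<^sub>e x = x\<close>, so \<open>1\<^sub>e\<close> is an identity element.\<close>

lemma one_homogeneous: "\<one> \<in> Bc \<e>"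
proof -
  let ?u = "part \<one> \<e>"
  have u: "?u \<in> carrier B" by simp
  have *: "?u \<otimes> x = x" if x: "x \<in> Bc h" and h: "h \<in> carrier G" for x h
  proof -
    have xc: "x \<in> carrier B" using x h comp_carrier by blast
    have "x = part (\<one> \<otimes> x) h"
      using x h xc by (simp add: part_homogeneous)
    also have "\<dots> = (\<Oplus>g\<in>supp \<one>. part (part \<one> g \<otimes> x) h)"
    proof -
      have "\<one> \<otimes> x = (\<Oplus>g\<in>supp \<one>. part \<one> g) \<otimes> x"
        using part_props(3)[OF one_closed] by simp
      also have "\<dots> = (\<Oplus>g\<in>supp \<one>. part \<one> g \<otimes> x)"
        using xc part_props(2)[OF one_closed] by (intro finsum_ldistr) auto
      finally show ?thesis
        using part_finsum[OF part_props(2)[OF one_closed], of "\<lambda>g. part \<one> g \<otimes> x" h] xc h by simp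
    qed
    \<comment> \<open>Degree \<open>\<e>\<close> is adjoined in case it is missing from the support
      of \<open>\<one>\<close>; the added term is then zero.\<close>
    also have "\<dots> = (\<Oplus>g\<in>insert \<e> (supp \<one>). part (part \<one> g \<otimes> x) h)"
      using xc h by (intro add.finprod_mono_neutral_cong_left)
        (auto simp: part_props(2) part_zero)
    also have "\<dots> = (\<Oplus>g\<in>insert \<e> (supp \<one>). if \<e> = g then ?u \<otimes> x else \<zero>)"
    proof (rule finsum_cong')
      fix g assume "g \<in> insert \<e> (supp \<one>)"
      then have g: "g \<in> carrier G" by auto
      \<comment> \<open>The product \<open>part \<one> g \<otimes> x\<close> has degree
        \<open>g \<star> h\<close>, so only \<open>g = \<e>\<close> contributes in degree
        \<open>h\<close>.\<close>
      have "(h = g \<star> h) \<longleftrightarrow> \<e> = g"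
        using g h G.r_cancel_one' by (metis G.l_one G.one_closed G.right_cancel)
      then show "part (part \<one> g \<otimes> x) h = (if \<e> = g then ?u \<otimes> x else \<zero>)"
        using g h x by (subst part_homogeneous[OF comp_mult[OF _ _ part_closed]]) auto
    qed (use xc in auto)
    also have "\<dots> = ?u \<otimes> x"
      using xc by (intro finsum_singleton) (auto simp: part_props(2))
    finally show ?thesis by simp
  qed
  \<comment> \<open>Since \<open>?u\<close> fixes every homogeneous component of
    \<open>\<one>\<close>, it fixes \<open>\<one>\<close> itself.\<close>
  have "?u = ?u \<otimes> \<one>" by simp
  also have "\<dots> = ?u \<otimes> (\<Oplus>g\<in>supp \<one>. part \<one> g)"
    using part_props(3)[OF one_closed] by simp
  also have "\<dots> = (\<Oplus>g\<in>supp \<one>. ?u \<otimes> part \<one> g)"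
    using part_props(2)[OF one_closed] by (intro finsum_rdistr) auto
  also have "\<dots> = (\<Oplus>g\<in>supp \<one>. part \<one> g)"
    by (intro finsum_cong') (auto intro!: * part_closed)
  also have "\<dots> = \<one>"
    using part_props(3)[OF one_closed] by simp
  finally show ?thesis
    using part_closed[OF one_closed G.one_closed] by simp
qed

end


section \<open>Epsilon-strongly graded rings\<close>

text \<open>Idempotency turns membership in the ideal into an equation, the form in which it enters
  the later calculations.\<close>

lemma (in ring) PIdl_central_idempotent:
  assumes "central_idempotent R e"
  shows "PIdl e = {s \<in> carrier R. s \<otimes> e = s}"
proof -
  have e: "e \<in> carrier R" "e \<otimes> e = e"
    using assms by (simp_all add: central_idempotent_def)
  then have "x \<otimes> e \<otimes> e = x \<otimes> e" if "x \<in> carrier R" for x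
    using that by (simp add: m_assoc)
  then show ?thesis
    using e unfolding cgenideal_def by (auto intro: sym)
qed

lemma (in ring) ideal_prod_central_idempotents:
  assumes "central_idempotent R d" "central_idempotent R e"
  shows "ideal_prod R (PIdl d) (PIdl e) = {s \<in> carrier R. s \<otimes> d = s \<and> s \<otimes> e = s}" (is "?P = ?Q")
proof -
  have de: "d \<in> carrier R" "e \<in> carrier R" "e \<otimes> e = e"
    and comm: "\<And>s. s \<in> carrier R \<Longrightarrow> d \<otimes> s = s \<otimes> d"
    using assms by (auto simp: central_idempotent_def)
  have "s \<in> ?Q" if "s \<in> ?P" for s
    using that
  proof (rule ideal_prod_memb)
    fix x y
    assume "x \<in> PIdl d" "y \<in> PIdl e"
    then have x: "x \<in> carrier R" "x \<otimes> d = x" and y: "y \<in> carrier R" "y \<otimes> e = y"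
      using assms by (auto simp: PIdl_central_idempotent)
    have "x \<otimes> y \<otimes> d = x \<otimes> d \<otimes> y"
      using x(1) y(1) de comm by (simp add: m_assoc)
    then show "x \<otimes> y \<in> ?Q"
      using x y de by (simp add: m_assoc)
  qed (use de in \<open>auto simp: l_distr\<close>)
  \<comment> \<open>One product suffices: \<open>s = s \<otimes> e\<close> with \<open>s\<close> in
    the first ideal and \<open>e\<close> in the second.\<close>
  moreover have "s \<in> ?P" if "s \<in> ?Q" for s
    using ideal_prod.prod[of s "PIdl d" e "PIdl e" R] that assms de
    by (auto simp: PIdl_central_idempotent)
  ultimately show ?thesis by blast
qed

section \<open>Moving the elements \<epsilon> past homogeneous elements\<close>

locale eps_graded = graded G B Bc
  for G :: "('g, 'k) monoid_scheme" and B (structure) and Bc :: "'g \<Rightarrow> 'b set" +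
  fixes \<epsilon> :: "'g \<Rightarrow> 'b"
  assumes eps: "epsilon_family G B Bc \<epsilon>"
begin

lemma inv_cancel [simp]:
  assumes "g \<in> carrier G" "h \<in> carrier G"
  shows "g\<acute> \<star> (g \<star> h) = h" "g \<star> (g\<acute> \<star> h) = h"
  using assms by (simp_all flip: G.m_assoc)

lemma eps_mem: "g \<in> carrier G \<Longrightarrow> \<epsilon> g \<in> ideal_prod B (Bc g) (Bc (g\<acute>))"
  using eps unfolding epsilon_family_def by blast

lemma eps_l: "\<lbrakk>x \<in> Bc g; g \<in> carrier G\<rbrakk> \<Longrightarrow> \<epsilon> g \<otimes> x = x"
  using eps unfolding epsilon_family_def by blast

lemma eps_r: "\<lbrakk>x \<in> Bc g; g \<in> carrier G\<rbrakk> \<Longrightarrow> x \<otimes> \<epsilon> (g\<acute>) = x"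
  using eps unfolding epsilon_family_def by blast

lemma ideal_prod_comp:
  assumes "z \<in> ideal_prod B (Bc g) (Bc h)" "g \<in> carrier G" "h \<in> carrier G"
  shows "z \<in> Bc (g \<star> h)"
  using assms(1) by (rule ideal_prod_memb) (use assms in \<open>auto intro: comp_mult comp_add\<close>)

lemma eps_comp: "g \<in> carrier G \<Longrightarrow> \<epsilon> g \<in> Bc \<e>"
  using ideal_prod_comp[OF eps_mem, of g] by simp

lemma eps_carrier [simp]: "g \<in> carrier G \<Longrightarrow> \<epsilon> g \<in> carrier B"
  using comp_carrier[OF eps_comp] by simp

lemma eps_prod_l:
  assumes "z \<in> ideal_prod B (Bc g) (Bc h)" "g \<in> carrier G" "h \<in> carrier G"
  shows "\<epsilon> g \<otimes> z = z"
proof -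
  have "z \<in> {z \<in> carrier B. \<epsilon> g \<otimes> z = z}"
    using assms(1)
  proof (rule ideal_prod_memb)
    fix x y assume "x \<in> Bc g" "y \<in> Bc h"
    then show "x \<otimes> y \<in> {z \<in> carrier B. \<epsilon> g \<otimes> z = z}"
      using assms comp_carrier[of x g] comp_carrier[of y h] by (simp add: eps_l flip: m_assoc)
  qed (use assms in \<open>auto simp: r_distr\<close>)
  then show ?thesis by simp
qed

lemma eps_prod_r:
  assumes "z \<in> ideal_prod B (Bc g) (Bc h)" "g \<in> carrier G" "h \<in> carrier G"
  shows "z \<otimes> \<epsilon> (h\<acute>) = z"
proof -
  have "z \<in> {z \<in> carrier B. z \<otimes> \<epsilon> (h\<acute>) = z}"
    using assms(1)
  proof (rule ideal_prod_memb)
    fix x y assume "x \<in> Bc g" "y \<in> Bc h"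
    then show "x \<otimes> y \<in> {z \<in> carrier B. z \<otimes> \<epsilon> (h\<acute>) = z}"
      using assms comp_carrier[of x g] comp_carrier[of y h] by (simp add: eps_r m_assoc)
  qed (use assms in \<open>auto simp: l_distr\<close>)
  then show ?thesis by simp
qed

lemma ideal_prod_l_mult:
  assumes "z \<in> ideal_prod B (Bc g) (Bc h)" "x \<in> Bc k" "g \<in> carrier G" "h \<in> carrier G" "k \<in> carrier G"
  shows "x \<otimes> z \<in> ideal_prod B (Bc (k \<star> g)) (Bc h)"
proof -
  have "z \<in> {z \<in> carrier B. x \<otimes> z \<in> ideal_prod B (Bc (k \<star> g)) (Bc h)}"
    using assms(1)
  proof (rule ideal_prod_memb)
    fix s t assume "s \<in> Bc g" "t \<in> Bc h"
    moreover from this have "x \<otimes> (s \<otimes> t) = (x \<otimes> s) \<otimes> t"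
      using assms comp_carrier by (metis m_assoc)
    ultimately show "s \<otimes> t \<in> {z \<in> carrier B. x \<otimes> z \<in> ideal_prod B (Bc (k \<star> g)) (Bc h)}"
      using assms by (auto intro!: ideal_prod.prod comp_mult intro: comp_carrier)
  qed (use assms comp_carrier[of x k] in \<open>auto simp: r_distr intro: ideal_prod.sum\<close>)
  then show ?thesis by simp
qed

lemma ideal_prod_r_mult:
  assumes "z \<in> ideal_prod B (Bc g) (Bc h)" "x \<in> Bc k" "g \<in> carrier G" "h \<in> carrier G" "k \<in> carrier G"
  shows "z \<otimes> x \<in> ideal_prod B (Bc g) (Bc (h \<star> k))"
proof -
  have "z \<in> {z \<in> carrier B. z \<otimes> x \<in> ideal_prod B (Bc g) (Bc (h \<star> k))}"
    using assms(1)
  proof (rule ideal_prod_memb)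
    fix s t assume "s \<in> Bc g" "t \<in> Bc h"
    moreover from this have "(s \<otimes> t) \<otimes> x = s \<otimes> (t \<otimes> x)"
      using assms comp_carrier by (metis m_assoc)
    ultimately show "s \<otimes> t \<in> {z \<in> carrier B. z \<otimes> x \<in> ideal_prod B (Bc g) (Bc (h \<star> k))}"
      using assms by (auto intro!: ideal_prod.prod comp_mult intro: comp_carrier)
  qed (use assms comp_carrier[of x k] in \<open>auto simp: l_distr intro: ideal_prod.sum\<close>)
  then show ?thesis by simp
qed

text \<open>Both sides lie in \<open>B\<^bsub>gh\<^esub>B\<^sub>k\<close> with \<open>k\<close> the inverse of \<open>h\<close>, hence both equal
  \<open>\<epsilon>\<^bsub>gh\<^esub>x\<epsilon>\<^sub>h\<close>.\<close>

lemma eps_shift: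
  assumes "x \<in> Bc g" "g \<in> carrier G" "h \<in> carrier G"
  shows "x \<otimes> \<epsilon> h = \<epsilon> (g \<star> h) \<otimes> x"
proof -
  have x: "x \<in> carrier B" using assms comp_carrier by blast
  have "x \<otimes> \<epsilon> h \<in> ideal_prod B (Bc (g \<star> h)) (Bc (h\<acute>))"
    using assms ideal_prod_l_mult[OF eps_mem] by simp
  then have 1: "\<epsilon> (g \<star> h) \<otimes> (x \<otimes> \<epsilon> h) = x \<otimes> \<epsilon> h"
    using assms by (intro eps_prod_l[where h = "h\<acute>"]) auto
  have "\<epsilon> (g \<star> h) \<otimes> x \<in> ideal_prod B (Bc (g \<star> h)) (Bc ((g \<star> h)\<acute> \<star> g))"
    using assms ideal_prod_r_mult[OF eps_mem] by simp
  also have "(g \<star> h)\<acute> \<star> g = h\<acute>"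
    using assms by (simp add: G.inv_mult_group G.m_assoc)
  finally have "\<epsilon> (g \<star> h) \<otimes> x \<otimes> \<epsilon> (h\<acute>\<acute>) = \<epsilon> (g \<star> h) \<otimes> x"
    using assms by (intro eps_prod_r[where g = "g \<star> h"]) auto
  then show ?thesis
    using 1 assms x by (simp add: m_assoc)
qed

lemma eps_comm:
  assumes "x \<in> Bc \<e>" "h \<in> carrier G"
  shows "x \<otimes> \<epsilon> h = \<epsilon> h \<otimes> x"
  using eps_shift[OF assms(1) _ assms(2)] assms by simp

lemma eps_idem [simp]: "g \<in> carrier G \<Longrightarrow> \<epsilon> g \<otimes> \<epsilon> g = \<epsilon> g"
  using eps_prod_l[OF eps_mem] by simp

lemma eps_one [simp]: "\<epsilon> \<e> = \<one>"
  using eps_l[OF one_homogeneous] by simp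

end

text \<open>\<open>S\<close> is only required to agree with \<open>B\<close> on the component of
  degree one. In the application it is the ring of matrices over \<open>R\<close>, whose products
  are formed by sums in \<open>R\<close>, whereas \<open>B\<close> forms them by sums in
  \<open>A\<close>; the two operations coincide on matrices over \<open>R\<close> only.\<close>

locale eps_graded_base = eps_graded G B Bc \<epsilon>
  for G :: "('g, 'k) monoid_scheme" and B (structure) and Bc :: "'g \<Rightarrow> 'b set" and \<epsilon> :: "'g \<Rightarrow> 'b" +
  fixes S :: "('b, 'n) ring_scheme"
  assumes S_carrier [simp]: "carrier S = Bc \<one>\<^bsub>G\<^esub>"
    and S_mult [simp]: "\<lbrakk>x \<in> Bc \<one>\<^bsub>G\<^esub>; y \<in> Bc \<one>\<^bsub>G\<^esub>\<rbrakk> \<Longrightarrow> x \<otimes>\<^bsub>S\<^esub> y = x \<otimes> y"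
    and S_add [simp]: "\<lbrakk>x \<in> Bc \<one>\<^bsub>G\<^esub>; y \<in> Bc \<one>\<^bsub>G\<^esub>\<rbrakk> \<Longrightarrow> x \<oplus>\<^bsub>S\<^esub> y = x \<oplus> y"
    and S_one [simp]: "\<one>\<^bsub>S\<^esub> = \<one>"
    and S_zero [simp]: "\<zero>\<^bsub>S\<^esub> = \<zero>"
begin

lemma base_carrier [simp]: "x \<in> Bc \<e> \<Longrightarrow> x \<in> carrier B"
  using comp_carrier[of x \<e>] by simp

lemma base_mult [simp]: "\<lbrakk>x \<in> Bc \<e>; y \<in> Bc \<e>\<rbrakk> \<Longrightarrow> x \<otimes> y \<in> Bc \<e>"
  using comp_mult'[of x \<e> y \<e> \<e>] by simp

lemma base_add [simp]: "\<lbrakk>x \<in> Bc \<e>; y \<in> Bc \<e>\<rbrakk> \<Longrightarrow> x \<oplus> y \<in> Bc \<e>"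
  using comp_add by simp

lemma base_ring: "ring S"
proof (rule ringI)
  show "abelian_group S"
  proof (rule abelian_groupI)
    fix x assume "x \<in> carrier S"
    then show "\<exists>y\<in>carrier S. y \<oplus>\<^bsub>S\<^esub> x = \<zero>\<^bsub>S\<^esub>"
      by (intro bexI[of _ "\<ominus> x"]) (auto simp: comp_neg l_neg)
  qed (auto simp: comp_zero a_ac)
  show "Group.monoid S"
    by (rule monoidI) (auto simp: one_homogeneous m_assoc)
qed (auto simp: l_distr r_distr)

sublocale S: ring S
  by (rule base_ring)

lemma eps_base [simp]: "g \<in> carrier G \<Longrightarrow> \<epsilon> g \<in> Bc \<e>"
  using eps_comp .

lemma eps_central: "g \<in> carrier G \<Longrightarrow> central_idempotent S (\<epsilon> g)"
  unfolding central_idempotent_def by (auto intro: eps_comm[symmetric])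

lemma PIdl_eps: "g \<in> carrier G \<Longrightarrow> PIdl\<^bsub>S\<^esub> (\<epsilon> g) = {s \<in> Bc \<e>. s \<otimes> \<epsilon> g = s}"
  by (auto simp: S.PIdl_central_idempotent[OF eps_central])

lemma ideal_prod_eps:
  "\<lbrakk>g \<in> carrier G; h \<in> carrier G\<rbrakk> \<Longrightarrow>
    ideal_prod S (PIdl\<^bsub>S\<^esub> (\<epsilon> g)) (PIdl\<^bsub>S\<^esub> (\<epsilon> h)) = {s \<in> Bc \<e>. s \<otimes> \<epsilon> g = s \<and> s \<otimes> \<epsilon> h = s}"
  by (auto simp: S.ideal_prod_central_idempotents[OF eps_central eps_central])

end


section \<open>Epsilon-invertible homogeneous elements\<close>

context eps_graded_base
begin

text \<open>Multiples of one fixed element are closed under addition, so finite sums collapse to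
  single products.\<close>

lemma ideal_prod_base_singleton:
  assumes "x \<in> carrier B"
  shows "ideal_prod B (Bc \<e>) {x} = {s \<otimes> x |s. s \<in> Bc \<e>}"
proof -
  have "z \<in> {s \<otimes> x |s. s \<in> Bc \<e>}" if "z \<in> ideal_prod B (Bc \<e>) {x}" for z
    using that
  proof (rule ideal_prod_memb)
    fix v w assume "v \<in> {s \<otimes> x |s. s \<in> Bc \<e>}" "w \<in> {s \<otimes> x |s. s \<in> Bc \<e>}"
    then obtain s t where "v = s \<otimes> x" "w = t \<otimes> x" "s \<in> Bc \<e>" "t \<in> Bc \<e>" by blast
    then show "v \<oplus> w \<in> {s \<otimes> x |s. s \<in> Bc \<e>}"
      using assms by (auto intro!: exI[of _ "s \<oplus> t"] simp: l_distr)
  qed auto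
  then show ?thesis
    by (auto intro!: ideal_prod.prod)
qed

lemma ideal_prod_singleton_base:
  assumes "x \<in> carrier B"
  shows "ideal_prod B {x} (Bc \<e>) = {x \<otimes> s |s. s \<in> Bc \<e>}"
proof -
  have "z \<in> {x \<otimes> s |s. s \<in> Bc \<e>}" if "z \<in> ideal_prod B {x} (Bc \<e>)" for z
    using that
  proof (rule ideal_prod_memb)
    fix v w assume "v \<in> {x \<otimes> s |s. s \<in> Bc \<e>}" "w \<in> {x \<otimes> s |s. s \<in> Bc \<e>}"
    then obtain s t where "v = x \<otimes> s" "w = x \<otimes> t" "s \<in> Bc \<e>" "t \<in> Bc \<e>" by blast
    then show "v \<oplus> w \<in> {x \<otimes> s |s. s \<in> Bc \<e>}"
      using assms by (auto intro!: exI[of _ "s \<oplus> t"] simp: r_distr)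
  qed auto
  then show ?thesis
    by (auto intro!: ideal_prod.prod)
qed

text \<open>A right inverse and a left inverse of the generator exist because \<open>\<epsilon>\<^sub>g \<in> \<kappa>SB\<^sub>k\<close> and
  \<open>\<epsilon>\<^sub>k \<in> B\<^sub>kS\<kappa>\<close> for the inverse \<open>k\<close> of \<open>g\<close>; the usual argument shows that they agree.\<close>

lemma generator_epsilon_invertible:
  assumes g: "g \<in> carrier G" and \<kappa>: "\<kappa> \<in> Bc g"
    and l: "ideal_prod B (carrier S) {\<kappa>} = Bc g" and r: "Bc g = ideal_prod B {\<kappa>} (carrier S)"
  shows "\<exists>b\<in>Bc (g\<acute>). \<kappa> \<otimes> b = \<epsilon> g \<and> b \<otimes> \<kappa> = \<epsilon> (g\<acute>)"
proof -
  have \<kappa>c: "\<kappa> \<in> carrier B" using \<kappa> g comp_carrier by blast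
  have g': "g\<acute> \<in> carrier G" using g by simp
  have "\<epsilon> g \<in> {\<kappa> \<otimes> c |c. c \<in> Bc (g\<acute>)}"
    using eps_mem[OF g]
  proof (rule ideal_prod_memb)
    fix x y assume x: "x \<in> Bc g" and y: "y \<in> Bc (g\<acute>)"
    then obtain s where s: "x = \<kappa> \<otimes> s" "s \<in> Bc \<e>"
      using r \<kappa>c by (auto simp: ideal_prod_singleton_base)
    moreover have "s \<otimes> y \<in> Bc (g\<acute>)"
      using s y g by (intro comp_mult'[of s \<e> y "g\<acute>"]) auto
    ultimately show "x \<otimes> y \<in> {\<kappa> \<otimes> c |c. c \<in> Bc (g\<acute>)}"
      using y g' comp_carrier[of y] \<kappa>c by (auto simp: m_assoc)
  next
    fix v w assume "v \<in> {\<kappa> \<otimes> c |c. c \<in> Bc (g\<acute>)}" "w \<in> {\<kappa> \<otimes> c |c. c \<in> Bc (g\<acute>)}"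
    then obtain c d where "v = \<kappa> \<otimes> c" "w = \<kappa> \<otimes> d" "c \<in> Bc (g\<acute>)" "d \<in> Bc (g\<acute>)" by blast
    then show "v \<oplus> w \<in> {\<kappa> \<otimes> c |c. c \<in> Bc (g\<acute>)}"
      using \<kappa>c g' comp_carrier[of _ "g\<acute>"] by (auto intro!: exI[of _ "c \<oplus> d"] simp: r_distr comp_add)
  qed
  then obtain c where c: "c \<in> Bc (g\<acute>)" "\<kappa> \<otimes> c = \<epsilon> g" by auto
  have "\<epsilon> (g\<acute>) \<in> {c \<otimes> \<kappa> |c. c \<in> Bc (g\<acute>)}"
    using eps_mem[OF g']
  proof (rule ideal_prod_memb)
    fix y x assume y: "y \<in> Bc (g\<acute>)" and "x \<in> Bc (g\<acute>\<acute>)"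
    then have "x \<in> Bc g" using g by simp
    then obtain s where s: "x = s \<otimes> \<kappa>" "s \<in> Bc \<e>"
      using l \<kappa>c by (auto simp: ideal_prod_base_singleton)
    moreover have "y \<otimes> s \<in> Bc (g\<acute>)"
      using s y g by (intro comp_mult'[of y "g\<acute>" s \<e>]) auto
    ultimately show "y \<otimes> x \<in> {c \<otimes> \<kappa> |c. c \<in> Bc (g\<acute>)}"
      using y g' comp_carrier[of y] \<kappa>c by (auto intro!: exI[of _ "y \<otimes> s"] simp: m_assoc)
  next
    fix v w assume "v \<in> {c \<otimes> \<kappa> |c. c \<in> Bc (g\<acute>)}" "w \<in> {c \<otimes> \<kappa> |c. c \<in> Bc (g\<acute>)}"
    then obtain c d where "v = c \<otimes> \<kappa>" "w = d \<otimes> \<kappa>" "c \<in> Bc (g\<acute>)" "d \<in> Bc (g\<acute>)" by blast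
    then show "v \<oplus> w \<in> {c \<otimes> \<kappa> |c. c \<in> Bc (g\<acute>)}"
      using \<kappa>c g' comp_carrier[of _ "g\<acute>"] by (auto intro!: exI[of _ "c \<oplus> d"] simp: l_distr comp_add)
  qed
  then obtain d where d: "d \<in> Bc (g\<acute>)" "d \<otimes> \<kappa> = \<epsilon> (g\<acute>)" by auto
  have "d = d \<otimes> (\<kappa> \<otimes> c)"
    using eps_r[OF d(1) g'] c g by simp
  also have "\<dots> = \<epsilon> (g\<acute>) \<otimes> c"
    using d c \<kappa>c g' comp_carrier by (metis m_assoc)
  also have "\<dots> = c"
    using eps_l[OF c(1) g'] .
  finally show ?thesis
    using c d by blast
qed

text \<open>Let \<open>\<kappa>\<close> correspond to the identity \<open>e\<close> of the twisted
  bimodule. Left linearity gives \<open>x = \<phi> x \<otimes> \<kappa>\<close>. On the right,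
  \<open>\<kappa> \<otimes> s\<close> corresponds to \<open>\<theta> s\<close> for \<open>s\<close>
  in the domain of \<open>\<theta>\<close>, and \<open>\<theta>\<close> is onto.\<close>

lemma generator_if_twisted_bimodule:
  assumes g: "g \<in> carrier G" and \<theta>: "t \<in> Iu S"
    and iso: "bimodule_iso S (sub_bimodule B (Bc g)) (twisted_bimodule S t) \<noteq> {}"
  shows "\<exists>\<kappa>\<in>Bc g. ideal_prod B (carrier S) {\<kappa>} = Bc g \<and> Bc g = ideal_prod B {\<kappa>} (carrier S)"
proof -
  obtain d e \<theta> where t: "t = (d, e, \<theta>)" by (cases t)
  from \<theta> have d: "central_idempotent S d" and e: "central_idempotent S e"
    and \<theta>: "\<theta> \<in> ring_iso (unital_ideal_ring S d) (unital_ideal_ring S e)"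
    by (auto simp: Iu_def t)
  have PI: "PIdl\<^bsub>S\<^esub> d = {s \<in> Bc \<e>. s \<otimes>\<^bsub>S\<^esub> d = s}" "PIdl\<^bsub>S\<^esub> e = {s \<in> Bc \<e>. s \<otimes>\<^bsub>S\<^esub> e = s}"
    by (simp_all add: S.PIdl_central_idempotent d e)
  have ec: "e \<in> Bc \<e>" "e \<otimes>\<^bsub>S\<^esub> e = e" and e_comm: "\<And>s. s \<in> Bc \<e> \<Longrightarrow> e \<otimes>\<^bsub>S\<^esub> s = s \<otimes>\<^bsub>S\<^esub> e"
    using e by (auto simp: central_idempotent_def)
  obtain \<phi> where bij: "bij_betw \<phi> (Bc g) (PIdl\<^bsub>S\<^esub> e)"
    and \<phi>l: "\<And>s x. \<lbrakk>s \<in> Bc \<e>; x \<in> Bc g\<rbrakk> \<Longrightarrow> \<phi> (s \<otimes> x) = s \<otimes>\<^bsub>S\<^esub> \<phi> x"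
    and \<phi>r: "\<And>s x. \<lbrakk>s \<in> Bc \<e>; x \<in> Bc g\<rbrakk> \<Longrightarrow> \<phi> (x \<otimes> s) = \<phi> x \<otimes>\<^bsub>S\<^esub> \<theta> (s \<otimes>\<^bsub>S\<^esub> d)"
    using iso unfolding bimodule_iso_def sub_bimodule_def twisted_bimodule_def t by auto
  have "e \<in> PIdl\<^bsub>S\<^esub> e" using ec by (simp add: PI)
  then obtain \<kappa> where \<kappa>: "\<kappa> \<in> Bc g" "\<phi> \<kappa> = e"
    using bij by (metis bij_betw_imp_surj_on imageE)
  have \<kappa>c: "\<kappa> \<in> carrier B" using \<kappa> g comp_carrier by blast
  have inj: "x = y" if "\<phi> x = \<phi> y" "x \<in> Bc g" "y \<in> Bc g" for x y
    using that bij by (auto simp: bij_betw_def inj_on_def)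
  have sk: "s \<otimes> \<kappa> \<in> Bc g" and ks: "\<kappa> \<otimes> s \<in> Bc g" if "s \<in> Bc \<e>" for s
    using that g \<kappa> by (auto intro: comp_mult')
  have 1: "x \<in> {s \<otimes> \<kappa> |s. s \<in> Bc \<e>}" if x: "x \<in> Bc g" for x
  proof -
    have \<phi>x: "\<phi> x \<in> Bc \<e>" "\<phi> x \<otimes>\<^bsub>S\<^esub> e = \<phi> x"
      using bij x by (auto simp: bij_betw_def PI)
    then have "\<phi> (\<phi> x \<otimes> \<kappa>) = \<phi> x"
      using \<phi>l \<kappa> by simp
    then show ?thesis
      using inj[OF _ sk x] \<phi>x by force
  qed
  have 2: "x \<in> {\<kappa> \<otimes> s |s. s \<in> Bc \<e>}" if x: "x \<in> Bc g" for x
  proof -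
    have \<phi>x: "\<phi> x \<in> PIdl\<^bsub>S\<^esub> e"
      using bij x by (auto simp: bij_betw_def)
    moreover have "\<theta> ` (PIdl\<^bsub>S\<^esub> d) = PIdl\<^bsub>S\<^esub> e"
      using \<theta> by (auto simp: ring_iso_def bij_betw_def unital_ideal_ring_def)
    ultimately obtain s where s: "s \<in> PIdl\<^bsub>S\<^esub> d" "\<theta> s = \<phi> x" by force
    then have s': "s \<in> Bc \<e>" "s \<otimes>\<^bsub>S\<^esub> d = s" by (auto simp: PI)
    then have "\<phi> (\<kappa> \<otimes> s) = e \<otimes>\<^bsub>S\<^esub> \<phi> x"
      using \<phi>r \<kappa> s by simp
    also have "\<dots> = \<phi> x"
      using \<phi>x e_comm by (auto simp: PI)
    finally show ?thesis
      using inj[OF _ ks x] s' by force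
  qed
  show ?thesis
    using \<kappa> sk ks 1 2
    by (intro bexI[of _ \<kappa>]) (auto simp: ideal_prod_base_singleton[OF \<kappa>c] ideal_prod_singleton_base[OF \<kappa>c])
qed

end

text \<open>The normalisation in degree one is responsible for the axioms that the action of the
  neutral element is the identity and that the twist is \<open>\<epsilon> g\<close> when one of its
  arguments is neutral.\<close>

locale crossed = eps_graded_base G B Bc \<epsilon> S
  for G :: "('g, 'k) monoid_scheme" and B (structure) and Bc :: "'g \<Rightarrow> 'b set" and \<epsilon> :: "'g \<Rightarrow> 'b"
    and S :: "('b, 'n) ring_scheme" +
  fixes a b :: "'g \<Rightarrow> 'b"
  assumes a: "g \<in> carrier G \<Longrightarrow> a g \<in> Bc g"
    and b: "g \<in> carrier G \<Longrightarrow> b g \<in> Bc (inv\<^bsub>G\<^esub> g)"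
    and ab [simp]: "g \<in> carrier G \<Longrightarrow> a g \<otimes> b g = \<epsilon> g"
    and ba [simp]: "g \<in> carrier G \<Longrightarrow> b g \<otimes> a g = \<epsilon> (inv\<^bsub>G\<^esub> g)"
    and a_one [simp]: "a \<one>\<^bsub>G\<^esub> = \<one>"
    and b_one [simp]: "b \<one>\<^bsub>G\<^esub> = \<one>"

lemma (in eps_graded_base) crossed_exists:
  assumes "\<And>g. g \<in> carrier G \<Longrightarrow>
    \<exists>a\<in>Bc g. \<exists>b\<in>Bc (g\<acute>). a \<otimes> b = \<epsilon> g \<and> b \<otimes> a = \<epsilon> (g\<acute>)"
  shows "\<exists>a b. crossed G B Bc \<epsilon> S a b"
proof -
  have "\<forall>g. \<exists>a b. g \<in> carrier G \<longrightarrow> a \<in> Bc g \<and> b \<in> Bc (g\<acute>) \<and>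
      a \<otimes> b = \<epsilon> g \<and> b \<otimes> a = \<epsilon> (g\<acute>)"
    using assms by blast
  then obtain a b where ab: "\<And>g. g \<in> carrier G \<Longrightarrow> a g \<in> Bc g \<and> b g \<in> Bc (g\<acute>) \<and>
      a g \<otimes> b g = \<epsilon> g \<and> b g \<otimes> a g = \<epsilon> (g\<acute>)"
    by metis
  \<comment> \<open>The pair in degree one may be replaced by \<open>\<one>, \<one>\<close> because
    \<open>\<epsilon> \<e> = \<one>\<close>.\<close>
  have "crossed G B Bc \<epsilon> S (a(\<e> := \<one>)) (b(\<e> := \<one>))"
    by unfold_locales (use ab one_homogeneous in auto)
  then show ?thesis by blast
qed

section \<open>Conjugation by the invertible elements and its twist\<close>

context crossed
begin

lemma ab_carrier [simp]:
  assumes "g \<in> carrier G"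
  shows "a g \<in> carrier B" "b g \<in> carrier B"
  using assms a b comp_carrier by (blast, metis G.inv_closed)

text \<open>The second form lets an \<epsilon> pass \<open>x\<close> inside a product that is
  associated to the right.\<close>

lemma eps_push_left:
  assumes "x \<in> Bc g" "g \<in> carrier G" "h \<in> carrier G"
  shows "x \<otimes> \<epsilon> h = \<epsilon> (g \<star> h) \<otimes> x"
    "y \<in> carrier B \<Longrightarrow> x \<otimes> (\<epsilon> h \<otimes> y) = \<epsilon> (g \<star> h) \<otimes> (x \<otimes> y)"
proof -
  show *: "x \<otimes> \<epsilon> h = \<epsilon> (g \<star> h) \<otimes> x"
    using eps_shift[OF assms] .
  show "x \<otimes> (\<epsilon> h \<otimes> y) = \<epsilon> (g \<star> h) \<otimes> (x \<otimes> y)" if "y \<in> carrier B"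
    using that assms comp_carrier[OF assms(1,2)] * by (simp flip: m_assoc)
qed

lemma ab_cancel [simp]:
  assumes "g \<in> carrier G" "x \<in> carrier B"
  shows "a g \<otimes> (b g \<otimes> x) = \<epsilon> g \<otimes> x" "b g \<otimes> (a g \<otimes> x) = \<epsilon> (g\<acute>) \<otimes> x"
  using assms by (simp_all flip: m_assoc)

text \<open>Products of homogeneous elements are compared by moving all \<open>\<epsilon>\<close>'s to the left. In the
  identities below, those that are redundant arrive there as \<open>\<epsilon>\<^sub>1 = 1\<close>.\<close>

lemmas push_simps = eps_push_left[OF a] eps_push_left[OF b] m_assoc G.m_assoc G.inv_mult_group

definition act :: "'g \<Rightarrow> 'b \<Rightarrow> 'b" where "act g r = a g \<otimes> r \<otimes> b g"
text \<open>The factor by which \<open>a\<close> fails to be multiplicative: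
  \<open>twist g h \<otimes> a (g \<star> h) = a g \<otimes> a h\<close>.\<close>

definition twist :: "'g \<Rightarrow> 'g \<Rightarrow> 'b" where "twist g h = a g \<otimes> a h \<otimes> b (g \<star> h)"

lemma conj_closed:
  assumes "r \<in> Bc \<e>" "x \<in> Bc g" "y \<in> Bc (g\<acute>)" "g \<in> carrier G"
  shows "x \<otimes> r \<otimes> y \<in> Bc \<e>"
  using assms comp_mult'[OF comp_mult'[OF assms(2,1,4) _ refl] assms(3)] by simp

lemma act_closed [simp]: "\<lbrakk>r \<in> Bc \<e>; g \<in> carrier G\<rbrakk> \<Longrightarrow> act g r \<in> Bc \<e>"
  unfolding act_def using conj_closed a b by blast

lemma coact_closed [simp]: "\<lbrakk>r \<in> Bc \<e>; g \<in> carrier G\<rbrakk> \<Longrightarrow> b g \<otimes> r \<otimes> a g \<in> Bc \<e>"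
  using conj_closed[of r "b g" "g\<acute>" "a g"] a b by simp

text \<open>On the ideal generated by \<open>\<epsilon> (g\<acute>)\<close> the idempotent on the
  right disappears, so conjugation with \<open>a g\<close> and \<open>b g\<close> exchanged undoes
  \<open>act g\<close> there.\<close>

lemma coact_act:
  assumes "r \<in> Bc \<e>" "g \<in> carrier G"
  shows "b g \<otimes> act g r \<otimes> a g = r \<otimes> \<epsilon> (g\<acute>)"
  using assms by (simp add: act_def push_simps eps_push_left[OF assms(1)] flip: m_assoc[of "\<epsilon> _" "\<epsilon> _"])

lemma act_coact:
  assumes "r \<in> Bc \<e>" "g \<in> carrier G"
  shows "act g (b g \<otimes> r \<otimes> a g) = r \<otimes> \<epsilon> g"
  using assms by (simp add: act_def push_simps eps_push_left[OF assms(1)] flip: m_assoc[of "\<epsilon> _" "\<epsilon> _"])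

lemma act_eps_image:
  assumes "r \<in> Bc \<e>" "g \<in> carrier G"
  shows "act g r \<otimes> \<epsilon> g = act g r"
  using assms eps_r[OF b] by (simp add: act_def m_assoc)

lemma coact_eps_image:
  assumes "r \<in> Bc \<e>" "g \<in> carrier G"
  shows "b g \<otimes> r \<otimes> a g \<otimes> \<epsilon> (g\<acute>) = b g \<otimes> r \<otimes> a g"
  using assms eps_r[OF a] by (simp add: m_assoc)

lemma act_eps:
  assumes "r \<in> Bc \<e>" "g \<in> carrier G" "h \<in> carrier G"
  shows "act g (r \<otimes> \<epsilon> h) = act g r \<otimes> \<epsilon> (g \<star> h)"
  using assms by (simp add: act_def push_simps eps_push_left[OF assms(1)])

lemma coact_eps:
  assumes "r \<in> Bc \<e>" "g \<in> carrier G" "h \<in> carrier G"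
  shows "b g \<otimes> (r \<otimes> \<epsilon> (g \<star> h)) \<otimes> a g = b g \<otimes> r \<otimes> a g \<otimes> \<epsilon> h"
  using assms by (simp add: push_simps eps_push_left[OF assms(1)])

lemma act_eps_unit: "g \<in> carrier G \<Longrightarrow> act g (\<epsilon> (g\<acute>)) = \<epsilon> g"
  by (simp add: act_def push_simps)

text \<open>The inner product \<open>b g \<otimes> a g\<close> is
  \<open>\<epsilon> (g\<acute>)\<close>; moved to the left past \<open>r\<close> and
  \<open>a g\<close> it becomes \<open>\<epsilon> \<e> = \<one>\<close>.\<close>

lemma act_mult:
  assumes "r \<in> Bc \<e>" "s \<in> Bc \<e>" "g \<in> carrier G"
  shows "act g (r \<otimes> s) = act g r \<otimes> act g s"
  using assms by (simp add: act_def push_simps eps_push_left[OF assms(1)])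

lemma act_add:
  assumes "r \<in> Bc \<e>" "s \<in> Bc \<e>" "g \<in> carrier G"
  shows "act g (r \<oplus> s) = act g r \<oplus> act g s"
  using assms by (simp add: act_def l_distr r_distr)

text \<open>Serves twice: for \<open>h = g\<acute>\<close> it is the bijection between the ideals of
  \<open>g\<acute>\<close> and \<open>g\<close>, and for general \<open>h\<close> it is the axiom on
  images of products of ideals.\<close>

lemma act_bij_betw:
  assumes "g \<in> carrier G" "h \<in> carrier G"
  shows "bij_betw (act g) {s \<in> Bc \<e>. s \<otimes> \<epsilon> (g\<acute>) = s \<and> s \<otimes> \<epsilon> h = s}
    {s \<in> Bc \<e>. s \<otimes> \<epsilon> g = s \<and> s \<otimes> \<epsilon> (g \<star> h) = s}"
  using assms
proof (intro bij_betw_byWitness[of _ "\<lambda>s. b g \<otimes> s \<otimes> a g"] ballI image_subsetI)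
  fix s assume "s \<in> {s \<in> Bc \<e>. s \<otimes> \<epsilon> (g\<acute>) = s \<and> s \<otimes> \<epsilon> h = s}"
  then show "b g \<otimes> act g s \<otimes> a g = s"
    "act g s \<in> {s \<in> Bc \<e>. s \<otimes> \<epsilon> g = s \<and> s \<otimes> \<epsilon> (g \<star> h) = s}"
    using assms act_eps[of s g h] by (auto simp: coact_act act_eps_image)
next
  fix s assume "s \<in> {s \<in> Bc \<e>. s \<otimes> \<epsilon> g = s \<and> s \<otimes> \<epsilon> (g \<star> h) = s}"
  then show "act g (b g \<otimes> s \<otimes> a g) = s"
    "b g \<otimes> s \<otimes> a g \<in> {s \<in> Bc \<e>. s \<otimes> \<epsilon> (g\<acute>) = s \<and> s \<otimes> \<epsilon> h = s}"
    using assms coact_eps[of s g h] by (auto simp: act_coact coact_eps_image)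
qed

text \<open>Formulated for any \<open>f\<close> that agrees with \<open>act g\<close> on the domain,
  so as to cover both \<open>act g\<close> itself and its restriction, the extensional map that
  \<open>Iu\<close> asks for.\<close>

lemma act_iso:
  assumes g: "g \<in> carrier G" and f: "\<And>r. r \<in> PIdl\<^bsub>S\<^esub> (\<epsilon> (g\<acute>)) \<Longrightarrow> f r = act g r"
  shows "f \<in> ring_iso (unital_ideal_ring S (\<epsilon> (g\<acute>))) (unital_ideal_ring S (\<epsilon> g))"
proof -
  \<comment> \<open>In degree \<open>g\<acute>\<close> the two conditions on the domain coincide,
    and the second condition on the image reads \<open>s \<otimes> \<one> = s\<close>.\<close>
  have bij: "bij_betw (act g) (PIdl\<^bsub>S\<^esub> (\<epsilon> (g\<acute>))) (PIdl\<^bsub>S\<^esub> (\<epsilon> g))"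
    using act_bij_betw[OF g, of "g\<acute>"] g
    by (simp add: PIdl_eps conj_comms cong: conj_cong)
  have mem: "act g r \<in> PIdl\<^bsub>S\<^esub> (\<epsilon> g)" if "r \<in> PIdl\<^bsub>S\<^esub> (\<epsilon> (g\<acute>))" for r
    using bij_betwE[OF bij] that by blast
  have PI: "r \<in> Bc \<e>" "r \<otimes> s \<in> PIdl\<^bsub>S\<^esub> (\<epsilon> (g\<acute>))" "r \<oplus> s \<in> PIdl\<^bsub>S\<^esub> (\<epsilon> (g\<acute>))"
    if "r \<in> PIdl\<^bsub>S\<^esub> (\<epsilon> (g\<acute>))" "s \<in> PIdl\<^bsub>S\<^esub> (\<epsilon> (g\<acute>))" for r s
    using that g by (auto simp: PIdl_eps m_assoc l_distr)
  have "f \<in> Ring.ring_hom (unital_ideal_ring S (\<epsilon> (g\<acute>))) (unital_ideal_ring S (\<epsilon> g))"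
  proof (rule ring_hom_memI, goal_cases)
    case (1 r)
    then show ?case using mem f by (simp add: unital_ideal_ring_def)
  next
    case (2 r s)
    then show ?case using f PI g by (simp add: unital_ideal_ring_def act_mult)
  next
    case (3 r s)
    then show ?case using f PI g by (simp add: unital_ideal_ring_def act_add)
  next
    case 4
    have "\<epsilon> (g\<acute>) \<in> PIdl\<^bsub>S\<^esub> (\<epsilon> (g\<acute>))" using g by (simp add: PIdl_eps)
    then show ?case using f g by (simp add: unital_ideal_ring_def act_eps_unit)
  qed
  moreover have "bij_betw f (PIdl\<^bsub>S\<^esub> (\<epsilon> (g\<acute>))) (PIdl\<^bsub>S\<^esub> (\<epsilon> g))"
    using bij f bij_betw_cong by blast
  ultimately show ?thesis
    by (simp add: ring_iso_def unital_ideal_ring_def)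
qed

lemma twisted_bimodule_exists:
  assumes g: "g \<in> carrier G"
  defines "t \<equiv> (\<epsilon> (g\<acute>), \<epsilon> g, restrict (act g) (PIdl\<^bsub>S\<^esub> (\<epsilon> (g\<acute>))))"
  shows "t \<in> Iu S" "bimodule_iso S (sub_bimodule B (Bc g)) (twisted_bimodule S t) \<noteq> {}"
proof -
  show "t \<in> Iu S"
    unfolding t_def Iu_def using g by (auto simp: eps_central intro: act_iso)
  have xb: "x \<otimes> b g \<in> Bc \<e>" "x \<otimes> b g \<otimes> \<epsilon> g = x \<otimes> b g" "x \<in> carrier B" if "x \<in> Bc g" for x
  proof -
    show x: "x \<in> carrier B" using that g comp_carrier by blast
    show "x \<otimes> b g \<in> Bc \<e>"
      using that g by (intro comp_mult'[OF that b]) auto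
    show "x \<otimes> b g \<otimes> \<epsilon> g = x \<otimes> b g"
      using g x eps_r[OF b] by (simp add: m_assoc)
  qed
  have ya: "y \<otimes> a g \<in> Bc g" if "y \<in> Bc \<e>" for y
    using that g by (intro comp_mult'[OF that a]) auto
  have bij: "bij_betw (\<lambda>x. x \<otimes> b g) (Bc g) (PIdl\<^bsub>S\<^esub> (\<epsilon> g))"
  proof (intro bij_betw_byWitness[of _ "\<lambda>y. y \<otimes> a g"] ballI image_subsetI)
    show "x \<otimes> b g \<otimes> a g = x" if "x \<in> Bc g" for x
      using that g xb[OF that] eps_r[OF that] by (simp add: m_assoc)
    show "y \<otimes> a g \<otimes> b g = y" "y \<otimes> a g \<in> Bc g" if "y \<in> PIdl\<^bsub>S\<^esub> (\<epsilon> g)" for y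
      using that g ya by (auto simp: PIdl_eps m_assoc)
    show "x \<otimes> b g \<in> PIdl\<^bsub>S\<^esub> (\<epsilon> g)" if "x \<in> Bc g" for x
      using that g xb by (auto simp: PIdl_eps)
  qed
  have add: "(x \<oplus> y) \<otimes> b g = x \<otimes> b g \<oplus>\<^bsub>S\<^esub> y \<otimes> b g" if "x \<in> Bc g" "y \<in> Bc g" for x y
    using xb g that by (simp add: l_distr)
  have left: "s \<otimes> x \<otimes> b g = s \<otimes>\<^bsub>S\<^esub> (x \<otimes> b g)" if "s \<in> Bc \<e>" "x \<in> Bc g" for s x
    using xb g that by (simp add: m_assoc)
  have right: "x \<otimes> s \<otimes> b g = x \<otimes> b g \<otimes>\<^bsub>S\<^esub> restrict (act g) (PIdl\<^bsub>S\<^esub> (\<epsilon> (g\<acute>))) (s \<otimes>\<^bsub>S\<^esub> \<epsilon> (g\<acute>))"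
    if s: "s \<in> Bc \<e>" and x: "x \<in> Bc g" for s x
  proof -
    have "s \<otimes> \<epsilon> (g\<acute>) \<in> PIdl\<^bsub>S\<^esub> (\<epsilon> (g\<acute>))"
      using s g by (simp add: PIdl_eps m_assoc)
    \<comment> \<open>On the right, \<open>b g \<otimes> a g = \<epsilon> (g\<acute>)\<close> and
      the factor \<open>\<epsilon> (g\<acute>)\<close> after \<open>s\<close> are both absorbed by
      \<open>x\<close>, the latter after commuting with \<open>s\<close>.\<close>
    moreover have "x \<otimes> s \<otimes> b g = x \<otimes> b g \<otimes> act g (s \<otimes> \<epsilon> (g\<acute>))"
      using s x xb g by (simp add: act_def push_simps eps_push_left[OF s] eps_push_left[OF x])
    ultimately show ?thesis
      using s x xb g by simp
  qed
  have "(\<lambda>x. x \<otimes> b g) \<in> bimodule_iso S (sub_bimodule B (Bc g)) (twisted_bimodule S t)"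
    unfolding bimodule_iso_def sub_bimodule_def twisted_bimodule_def t_def
    using bij add left right by simp
  then show "bimodule_iso S (sub_bimodule B (Bc g)) (twisted_bimodule S t) \<noteq> {}"
    by blast
qed

end


section \<open>From epsilon-crossed products to partial crossed products\<close>

text \<open>Supplies uniqueness of inverses, so that \<open>inv\<close> in this ring can be
  evaluated by exhibiting an inverse.\<close>

lemma (in ring) prod_ideal_ring_monoid:
  assumes "central_idempotent R d" "central_idempotent R e"
  shows "Group.monoid (prod_ideal_ring R d e)"
proof -
  have de: "d \<in> carrier R" "e \<in> carrier R" "d \<otimes> d = d" "e \<otimes> e = e"
    and d: "\<And>s. s \<in> carrier R \<Longrightarrow> d \<otimes> s = s \<otimes> d"
    and e: "\<And>s. s \<in> carrier R \<Longrightarrow> e \<otimes> s = s \<otimes> e"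
    using assms by (auto simp: central_idempotent_def)
  let ?C = "{s \<in> carrier R. s \<otimes> d = s \<and> s \<otimes> e = s}"
  have sde: "s \<otimes> (d \<otimes> e) = s" if "s \<in> ?C" for s
    using that de by (simp flip: m_assoc)
  have [simp]: "d \<otimes> e \<otimes> d = d \<otimes> e" "d \<otimes> e \<otimes> e = d \<otimes> e"
    using de by (simp add: m_assoc d[of e, symmetric] flip: m_assoc[of d d], simp add: m_assoc)
  have "d \<otimes> e \<otimes> s = s \<otimes> (d \<otimes> e)" if "s \<in> carrier R" for s
  proof -
    have "d \<otimes> e \<otimes> s = d \<otimes> (s \<otimes> e)"
      using that de by (simp add: m_assoc e[OF that])
    also have "\<dots> = s \<otimes> (d \<otimes> e)"
      using that de by (simp add: d[OF that] flip: m_assoc)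
    finally show ?thesis .
  qed
  then have dse: "d \<otimes> e \<otimes> s = s" if "s \<in> ?C" for s
    using that sde by simp
  show ?thesis
  proof (rule monoidI, unfold prod_ideal_ring_def, simp_all add: ideal_prod_central_idempotents[OF assms], goal_cases)
    case (1 x y)
    then show ?case using de by (simp add: m_assoc)
  next
    case 2
    then show ?case using de by simp
  next
    case (3 x y z)
    then show ?case by (simp add: m_assoc)
  next
    case (4 x)
    then show ?case using dse by simp
  next
    case (5 x)
    then show ?case using sde by simp
  qed
qed

lemma (in ring) prod_ideal_ring_unit:
  assumes "central_idempotent R d" "central_idempotent R e"
    and "w \<in> carrier R" "w \<otimes> d = w" "w \<otimes> e = w" "v \<in> carrier R" "v \<otimes> d = v" "v \<otimes> e = v"
    and "w \<otimes> v = d \<otimes> e" "v \<otimes> w = d \<otimes> e"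
  shows "w \<in> Units (prod_ideal_ring R d e)" "inv\<^bsub>prod_ideal_ring R d e\<^esub> w = v"
proof -
  interpret P: Group.monoid "prod_ideal_ring R d e"
    using assms by (intro prod_ideal_ring_monoid)
  have mem: "w \<in> carrier (prod_ideal_ring R d e)" "v \<in> carrier (prod_ideal_ring R d e)"
    "w \<otimes>\<^bsub>prod_ideal_ring R d e\<^esub> v = \<one>\<^bsub>prod_ideal_ring R d e\<^esub>"
    "v \<otimes>\<^bsub>prod_ideal_ring R d e\<^esub> w = \<one>\<^bsub>prod_ideal_ring R d e\<^esub>"
    using assms by (simp_all add: prod_ideal_ring_def ideal_prod_central_idempotents)
  then show "w \<in> Units (prod_ideal_ring R d e)"
    unfolding Units_def by blast
  show "inv\<^bsub>prod_ideal_ring R d e\<^esub> w = v"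
    using mem by (intro P.inv_char)
qed

text \<open>The two sums are taken in different structures. Over an infinite index set both have the
  default value zero.\<close>

lemma (in eps_graded_base) finsum_base:
  assumes "\<And>i. i \<in> I \<Longrightarrow> f i \<in> Bc \<e>"
  shows "finsum S f I = finsum B f I"
  using assms
proof (induction I rule: infinite_finite_induct)
  case (insert x F)
  then show ?case
    by (simp add: Pi_iff comp_finsum)
qed auto

context crossed
begin

lemma twist_closed: "\<lbrakk>g \<in> carrier G; h \<in> carrier G\<rbrakk> \<Longrightarrow> twist g h \<in> Bc \<e>"
  unfolding twist_def by (rule comp_mult'[OF comp_mult'[OF a a _ _ refl] b]) auto

lemma twist_inverse_closed:
  "\<lbrakk>g \<in> carrier G; h \<in> carrier G\<rbrakk> \<Longrightarrow> a (g \<star> h) \<otimes> b h \<otimes> b g \<in> Bc \<e>"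
  by (rule comp_mult'[OF comp_mult'[OF a b _ _ refl] b]) (auto simp: G.m_assoc)

text \<open>The inverse exchanges \<open>a\<close> and \<open>b\<close> and reverses the order of
  the factors. The inner products collapse to \<epsilon>'s: \<open>a g \<otimes> a h \<otimes> b h
  \<otimes> b g = a g \<otimes> \<epsilon> h \<otimes> b g = \<epsilon> (g \<star> h) \<otimes>
  \<epsilon> g\<close>.\<close>

lemma twist_unit:
  assumes g: "g \<in> carrier G" and h: "h \<in> carrier G"
  shows "twist g h \<in> Units (prod_ideal_ring S (\<epsilon> g) (\<epsilon> (g \<star> h)))"
    and "inv\<^bsub>prod_ideal_ring S (\<epsilon> g) (\<epsilon> (g \<star> h))\<^esub> (twist g h) = a (g \<star> h) \<otimes> b h \<otimes> b g"
proof -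
  let ?w = "twist g h" and ?v = "a (g \<star> h) \<otimes> b h \<otimes> b g"
  have gh: "g \<star> h \<in> carrier G" using g h by simp
  have closed: "?w \<in> Bc \<e>" "?v \<in> Bc \<e>"
    using g h twist_closed twist_inverse_closed by auto
  \<comment> \<open>The leftmost factor \<open>a g\<close> absorbs \<open>\<epsilon> g\<close>;
    centrality in \<open>S\<close> moves it to the right end.\<close>
  have "?w \<otimes> \<epsilon> g = ?w"
  proof -
    have "\<epsilon> g \<otimes> ?w = ?w"
      using g h gh eps_l[OF a] by (simp add: twist_def flip: m_assoc)
    then show ?thesis using closed g by (simp add: eps_comm)
  qed
  moreover have "?w \<otimes> \<epsilon> (g \<star> h) = ?w"
    using g h gh eps_r[OF b, of "g \<star> h"] by (simp add: twist_def m_assoc)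
  moreover have "?v \<otimes> \<epsilon> g = ?v"
    using g h gh eps_r[OF b, of g] by (simp add: m_assoc)
  moreover have "?v \<otimes> \<epsilon> (g \<star> h) = ?v"
  proof -
    have "\<epsilon> (g \<star> h) \<otimes> ?v = ?v"
      using g h gh eps_l[OF a, of "g \<star> h"] by (simp flip: m_assoc)
    then show ?thesis using closed gh by (simp add: eps_comm)
  qed
  moreover have "?w \<otimes> ?v = \<epsilon> g \<otimes> \<epsilon> (g \<star> h)"
    using g h eps_comm[of "\<epsilon> g" "g \<star> h"] by (simp add: twist_def push_simps)
  moreover have "?v \<otimes> ?w = \<epsilon> g \<otimes> \<epsilon> (g \<star> h)"
    using g h by (simp add: twist_def push_simps)
  ultimately show "?w \<in> Units (prod_ideal_ring S (\<epsilon> g) (\<epsilon> (g \<star> h)))"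
    and "inv\<^bsub>prod_ideal_ring S (\<epsilon> g) (\<epsilon> (g \<star> h))\<^esub> ?w = ?v"
    using S.prod_ideal_ring_unit[OF eps_central[OF g] eps_central[OF gh], of ?w ?v] closed g gh
    by simp_all
qed

lemma PIdl_one: "PIdl\<^bsub>S\<^esub> \<one> = Bc \<e>"
proof -
  have "PIdl\<^bsub>S\<^esub> \<one> = {s \<in> Bc \<e>. s \<otimes> \<one> = s}"
    using PIdl_eps[OF G.one_closed] by simp
  also have "\<dots> = Bc \<e>"
    by auto
  finally show ?thesis .
qed

lemma unital_twisted_partial_action: "unital_twisted_partial_action G S \<epsilon> act twist"
proof (unfold_locales, goal_cases)
  case (1 g)
  then show ?case by (rule eps_central)
next
  case (2 g)
  then show ?case by (rule act_iso) simp
next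
  case 4
  then show ?case by (simp add: PIdl_one)
next
  case (5 s)
  then show ?case by (simp add: act_def)
next
  case (8 g)
  then show ?case by (simp add: twist_def)
next
  case (3 g h)
  then show ?case by (rule twist_unit)
next
  case (6 g h)
  then show ?case
    using act_bij_betw[of g h] by (simp add: ideal_prod_eps bij_betw_imp_surj_on)
next
  case (7 g h t)
  have t: "t \<in> Bc \<e>" using 7 by (simp add: ideal_prod_eps)
  \<comment> \<open>Both sides equal
    \<open>a g \<otimes> a h \<otimes> t \<otimes> b h \<otimes> b g\<close>: the two inner products
    of \<open>b (g \<star> h)\<close> and \<open>a (g \<star> h)\<close> become
    \<open>\<one>\<close> after passing \<open>a g \<otimes> a h\<close>.\<close>
  have "act g (act h t) = twist g h \<otimes> act (g \<star> h) t \<otimes> (a (g \<star> h) \<otimes> b h \<otimes> b g)"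
    using 7 t by (simp add: act_def twist_def push_simps eps_push_left[OF t])
  then show ?case
    using 7 t twist_unit(2)[of g h] twist_closed twist_inverse_closed by simp
next
  case (9 g h l)
  \<comment> \<open>Both sides reduce to \<open>a g \<otimes> a h \<otimes> a l \<otimes> b (g
    \<star> h \<star> l)\<close>.\<close>
  have "act g (twist h l \<otimes> \<epsilon> (g\<acute>)) \<otimes> twist g (h \<star> l) = twist g h \<otimes> twist (g \<star> h) l"
    using 9 by (simp add: act_def twist_def push_simps)
  then show ?case
    using 9 twist_closed by simp
qed

text \<open>Every homogeneous part of \<open>x\<close> is multiplied on the right by the
  corresponding \<open>b g\<close>; the inverse map sends \<open>c\<close> to the sum of the
  \<open>c g \<otimes> a g\<close>.\<close>

lemma partial_crossed_product_iso:
  "graded_iso G B Bc (partial_crossed_product G S \<epsilon> act twist)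
    (partial_crossed_product_comp G S \<epsilon> act twist) \<noteq> {}"
proof -
  let ?C = "partial_crossed_product G S \<epsilon> act twist"
  define \<phi> where "\<phi> = (\<lambda>x. \<lambda>g\<in>carrier G. part x g \<otimes> b g)"
  have C: "carrier ?C = {c \<in> \<Pi>\<^sub>E g\<in>carrier G. {s \<in> Bc \<e>. s \<otimes> \<epsilon> g = s}. finite {g \<in> carrier G. c g \<noteq> \<zero>}}"
    by (auto simp: partial_crossed_product_def PIdl_eps PiE_iff)
  have xb: "x \<otimes> b g \<in> Bc \<e>" if "x \<in> Bc g" "g \<in> carrier G" for x g
    using that by (intro comp_mult'[OF _ b]) auto
  have xba: "x \<otimes> b g \<otimes> a g = x" if "x \<in> Bc g" "g \<in> carrier G" for x g
    using that comp_carrier[of x g] eps_r[of x g] by (simp add: m_assoc)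
  have ya: "y \<otimes> a g \<in> Bc g" if "y \<in> Bc \<e>" "g \<in> carrier G" for y g
    using that by (intro comp_mult'[OF _ a, of _ \<e>]) auto
  \<comment> \<open>Right multiplication by \<open>a g\<close> recovers the part, so
    \<open>\<phi>\<close> preserves supports and the index sets of the two multiplications
    coincide.\<close>
  have nz: "part x g \<otimes> b g \<noteq> \<zero> \<longleftrightarrow> part x g \<noteq> \<zero>" if "x \<in> carrier B" "g \<in> carrier G" for x g
    using that xba[OF part_closed[OF that]] by auto
  have closed: "\<phi> x \<in> carrier ?C" if x: "x \<in> carrier B" for x
  proof -
    have "part x g \<otimes> b g \<otimes> \<epsilon> g = part x g \<otimes> b g" if "g \<in> carrier G" for g
      using that x eps_r[OF b, of g] by (simp add: m_assoc)
    moreover have "{g \<in> carrier G. \<phi> x g \<noteq> \<zero>} \<subseteq> supp x"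
      by (auto simp: \<phi>_def)
    then have "finite {g \<in> carrier G. \<phi> x g \<noteq> \<zero>}"
      using part_props(2)[OF x] finite_subset by blast
    ultimately show ?thesis
      unfolding C using x by (auto simp: \<phi>_def xb part_closed)
  qed
  have \<phi>_inj: "x = y" if "x \<in> carrier B" "y \<in> carrier B" "\<phi> x = \<phi> y" for x y
  proof (rule eq_if_parts_eq[OF that(1,2)])
    fix g assume g: "g \<in> carrier G"
    then have "part x g \<otimes> b g = part y g \<otimes> b g"
      using fun_cong[OF that(3), of g] by (simp add: \<phi>_def)
    then show "part x g = part y g"
      using xba[OF part_closed] that g by metis
  qed
  \<comment> \<open>The parts of the preimage are recorded for later use: they show that a
    homogeneous \<open>c\<close> has a homogeneous preimage.\<close>
  have surj: "\<exists>x\<in>carrier B. \<phi> x = c \<and> (\<forall>g\<in>carrier G. part x g = c g \<otimes> a g)" if c: "c \<in> carrier ?C" for c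
  proof -
    let ?F = "{g \<in> carrier G. c g \<noteq> \<zero>}"
    let ?x = "\<Oplus>g\<in>?F. c g \<otimes> a g"
    have cg: "c g \<in> Bc \<e>" "c g \<otimes> \<epsilon> g = c g" if "g \<in> carrier G" for g
      using c that unfolding C by (auto dest: PiE_mem)
    have fin: "finite ?F" using c unfolding C by blast
    have x: "?x \<in> carrier B"
      using cg by (intro finsum_closed) auto
    have p: "part ?x g = c g \<otimes> a g" if "g \<in> carrier G" for g
      using that fin cg ya by (subst part_finsum_eq) auto
    have "\<phi> ?x = c"
    proof (rule PiE_ext[of _ "carrier G" "\<lambda>_. Bc \<e>"])
      show "\<phi> ?x \<in> (\<Pi>\<^sub>E g\<in>carrier G. Bc \<e>)" "c \<in> (\<Pi>\<^sub>E g\<in>carrier G. Bc \<e>)"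
        using closed[OF x] c unfolding C by (auto dest: PiE_mem simp: PiE_iff)
      show "\<phi> ?x g = c g" if "g \<in> carrier G" for g
        using that p cg by (simp add: \<phi>_def m_assoc)
    qed
    then show ?thesis
      using p x by blast
  qed
  have mult: "\<phi> (x \<otimes> y) = \<phi> x \<otimes>\<^bsub>?C\<^esub> \<phi> y" if x: "x \<in> carrier B" and y: "y \<in> carrier B" for x y
  proof (rule extensionalityI[of _ "carrier G"])
    fix k assume k: "k \<in> carrier G"
    let ?P = "{(g, h). g \<in> carrier G \<and> h \<in> carrier G \<and> part x g \<noteq> \<zero> \<and> part y h \<noteq> \<zero> \<and> g \<star> h = k}"
    let ?Q = "{(g, h). g \<in> carrier G \<and> h \<in> carrier G \<and> \<phi> x g \<noteq> \<zero>\<^bsub>S\<^esub> \<and> \<phi> y h \<noteq> \<zero>\<^bsub>S\<^esub> \<and> g \<star> h = k}"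
    let ?f = "\<lambda>(g, h). \<phi> x g \<otimes>\<^bsub>S\<^esub> act g (\<phi> y h \<otimes>\<^bsub>S\<^esub> \<epsilon> (g\<acute>)) \<otimes>\<^bsub>S\<^esub> twist g h"
    have PQ: "?Q = ?P"
      using nz[OF x] nz[OF y] by (auto simp: \<phi>_def)
    have fin: "finite ?P"
      by (rule finite_subset[of _ "supp x \<times> supp y"]) (use x y part_props(2) in auto)
    have eq: "part x g \<otimes> part y h \<otimes> b (g \<star> h) = ?f (g, h)"
      if g: "g \<in> carrier G" and h: "h \<in> carrier G" for g h
    proof -
      note p = part_closed[OF x g] part_closed[OF y h]
      \<comment> \<open>On the right the inner products \<open>b g \<otimes> a g\<close> and
        \<open>b h \<otimes> a h\<close> and the factor \<open>\<epsilon> (g\<acute>)\<close> all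
        turn into \<open>\<one>\<close> on their way to the left.\<close>
      have "part x g \<otimes> part y h \<otimes> b (g \<star> h) =
          part x g \<otimes> b g \<otimes> act g (part y h \<otimes> b h \<otimes> \<epsilon> (g\<acute>)) \<otimes> twist g h"
        using g h x y by (simp add: act_def twist_def push_simps eps_push_left[OF p(1)] eps_push_left[OF p(2)])
      then show ?thesis
        using g h p xb twist_closed by (simp add: \<phi>_def)
    qed
    have mem: "?f (g, h) \<in> Bc \<e>" if g: "g \<in> carrier G" and h: "h \<in> carrier G" for g h
      using g h part_closed[OF x g] part_closed[OF y h] xb twist_closed by (simp add: \<phi>_def)
    have "\<phi> (x \<otimes> y) k = (\<Oplus>p\<in>?P. part x (fst p) \<otimes> part y (snd p)) \<otimes> b k"
      using k x y by (simp add: \<phi>_def part_mult)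
    also have "\<dots> = (\<Oplus>p\<in>?P. part x (fst p) \<otimes> part y (snd p) \<otimes> b k)"
      using fin k x y by (intro finsum_ldistr) auto
    also have "\<dots> = finsum B ?f ?P"
      using mem eq by (intro finsum_cong') auto
    also have "\<dots> = finsum S ?f ?Q"
      unfolding PQ using mem by (intro finsum_base[symmetric]) auto
    finally show "\<phi> (x \<otimes> y) k = (\<phi> x \<otimes>\<^bsub>?C\<^esub> \<phi> y) k"
      using k by (simp add: partial_crossed_product_def)
  qed (auto simp: \<phi>_def partial_crossed_product_def)
  have "\<phi> \<in> Ring.ring_hom B ?C"
  proof (rule ring_hom_memI)
    fix x y assume x: "x \<in> carrier B" and y: "y \<in> carrier B"
    show "\<phi> x \<in> carrier ?C" "\<phi> (x \<otimes> y) = \<phi> x \<otimes>\<^bsub>?C\<^esub> \<phi> y"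
      using closed mult x y by blast+
    have "part x g \<otimes> b g \<oplus>\<^bsub>S\<^esub> part y g \<otimes> b g = part (x \<oplus> y) g \<otimes> b g" if "g \<in> carrier G" for g
      using that x y xb[OF part_closed] by (simp add: part_add l_distr)
    then show "\<phi> (x \<oplus> y) = \<phi> x \<oplus>\<^bsub>?C\<^esub> \<phi> y"
      by (auto simp: \<phi>_def partial_crossed_product_def)
  next
    have "part \<one> g = (if g = \<e> then \<one> else \<zero>)" if "g \<in> carrier G" for g
      using that by (intro part_homogeneous one_homogeneous) auto
    then show "\<phi> \<one> = \<one>\<^bsub>?C\<^esub>"
      by (auto simp: \<phi>_def partial_crossed_product_def)
  qed
  moreover have "bij_betw \<phi> (carrier B) (carrier ?C)"
    unfolding bij_betw_def inj_on_def using closed \<phi>_inj surj by blast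
  ultimately have iso: "\<phi> \<in> ring_iso B ?C"
    by (simp add: ring_iso_def)
  have "\<phi> ` Bc g = partial_crossed_product_comp G S \<epsilon> act twist g" if g: "g \<in> carrier G" for g
  proof (intro equalityI subsetI)
    fix c assume "c \<in> \<phi> ` Bc g"
    then obtain x where x: "x \<in> Bc g" "c = \<phi> x" by blast
    then show "c \<in> partial_crossed_product_comp G S \<epsilon> act twist g"
      using g closed comp_carrier[OF x(1) g]
      by (auto simp: partial_crossed_product_comp_def \<phi>_def part_homogeneous)
  next
    fix c assume "c \<in> partial_crossed_product_comp G S \<epsilon> act twist g"
    then have c: "c \<in> carrier ?C" "\<And>h. \<lbrakk>h \<in> carrier G; h \<noteq> g\<rbrakk> \<Longrightarrow> c h = \<zero>"
      by (auto simp: partial_crossed_product_comp_def)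
    then obtain x where x: "x \<in> carrier B" "\<phi> x = c" "\<forall>h\<in>carrier G. part x h = c h \<otimes> a h"
      using surj by blast
    \<comment> \<open>In degrees other than \<open>g\<close> the function \<open>c\<close> vanishes,
      hence so do the parts \<open>c h \<otimes> a h\<close> of \<open>x\<close>.\<close>
    have "x = part x g"
    proof (rule eq_if_parts_eq)
      fix h assume h: "h \<in> carrier G"
      show "part x h = part (part x g) h"
        using h g x c by (subst part_homogeneous[OF part_closed]) auto
    qed (rule x(1), rule part_carrier[OF x(1) g])
    then have "x \<in> Bc g" using part_closed[OF x(1) g] by simp
    then show "c \<in> \<phi> ` Bc g" using x by blast
  qed
  then have "\<phi> \<in> graded_iso G B Bc ?C (partial_crossed_product_comp G S \<epsilon> act twist)"
    using iso by (simp add: graded_iso_def)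
  then show ?thesis by blast
qed

end


section \<open>From partial crossed products to epsilon-crossed products\<close>

context unital_twisted_partial_action
begin

lemma u_props:
  assumes "g \<in> carrier G"
  shows u_closed [simp]: "u g \<in> carrier S" and u_idem [simp]: "u g \<otimes>\<^bsub>S\<^esub> u g = u g"
    and u_comm: "s \<in> carrier S \<Longrightarrow> u g \<otimes>\<^bsub>S\<^esub> s = s \<otimes>\<^bsub>S\<^esub> u g"
  using u_central[OF assms] by (auto simp: central_idempotent_def)

abbreviation D :: "'g \<Rightarrow> 's set" where "D g \<equiv> {s \<in> carrier S. s \<otimes>\<^bsub>S\<^esub> u g = s}"

lemma PIdl_u: "g \<in> carrier G \<Longrightarrow> PIdl\<^bsub>S\<^esub> (u g) = D g"
  using S.PIdl_central_idempotent[OF u_central] .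

lemma u_one [simp]: "u \<one>\<^bsub>G\<^esub> = \<one>\<^bsub>S\<^esub>"
proof -
  have "\<one>\<^bsub>S\<^esub> \<in> D \<one>\<^bsub>G\<^esub>"
    using D_one PIdl_u[OF one_closed] by simp
  then show ?thesis by simp
qed

lemma \<alpha>_props:
  assumes "g \<in> carrier G"
  shows \<alpha>_closed: "s \<in> D (inv\<^bsub>G\<^esub> g) \<Longrightarrow> \<alpha> g s \<in> D g"
    and \<alpha>_mult: "\<lbrakk>s \<in> D (inv\<^bsub>G\<^esub> g); t \<in> D (inv\<^bsub>G\<^esub> g)\<rbrakk> \<Longrightarrow> \<alpha> g (s \<otimes>\<^bsub>S\<^esub> t) = \<alpha> g s \<otimes>\<^bsub>S\<^esub> \<alpha> g t"
    and \<alpha>_add: "\<lbrakk>s \<in> D (inv\<^bsub>G\<^esub> g); t \<in> D (inv\<^bsub>G\<^esub> g)\<rbrakk> \<Longrightarrow> \<alpha> g (s \<oplus>\<^bsub>S\<^esub> t) = \<alpha> g s \<oplus>\<^bsub>S\<^esub> \<alpha> g t"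
    and \<alpha>_unit: "\<alpha> g (u (inv\<^bsub>G\<^esub> g)) = u g"
proof -
  have "\<alpha> g \<in> Ring.ring_hom (unital_ideal_ring S (u (inv\<^bsub>G\<^esub> g))) (unital_ideal_ring S (u g))"
    using \<alpha>_iso[OF assms] by (simp add: ring_iso_def)
  note h = ring_hom_memE[OF this, unfolded unital_ideal_ring_def, simplified]
  have PI: "PIdl\<^bsub>S\<^esub> (u (inv\<^bsub>G\<^esub> g)) = D (inv\<^bsub>G\<^esub> g)" "PIdl\<^bsub>S\<^esub> (u g) = D g"
    by (rule PIdl_u[OF inv_closed[OF assms]], rule PIdl_u[OF assms])
  show "s \<in> D (inv\<^bsub>G\<^esub> g) \<Longrightarrow> \<alpha> g s \<in> D g"
    using h(1)[of s] unfolding PI .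
  show "\<lbrakk>s \<in> D (inv\<^bsub>G\<^esub> g); t \<in> D (inv\<^bsub>G\<^esub> g)\<rbrakk> \<Longrightarrow> \<alpha> g (s \<otimes>\<^bsub>S\<^esub> t) = \<alpha> g s \<otimes>\<^bsub>S\<^esub> \<alpha> g t"
    using h(2)[of s t] unfolding PI .
  show "\<lbrakk>s \<in> D (inv\<^bsub>G\<^esub> g); t \<in> D (inv\<^bsub>G\<^esub> g)\<rbrakk> \<Longrightarrow> \<alpha> g (s \<oplus>\<^bsub>S\<^esub> t) = \<alpha> g s \<oplus>\<^bsub>S\<^esub> \<alpha> g t"
    using h(3)[of s t] unfolding PI .
  show "\<alpha> g (u (inv\<^bsub>G\<^esub> g)) = u g"
    using h(4) .
qed

lemma \<alpha>_zero:
  assumes "g \<in> carrier G"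
  shows "\<alpha> g \<zero>\<^bsub>S\<^esub> = \<zero>\<^bsub>S\<^esub>"
proof -
  have 0: "\<zero>\<^bsub>S\<^esub> \<in> D (inv\<^bsub>G\<^esub> g)" using assms by simp
  then have "\<alpha> g \<zero>\<^bsub>S\<^esub> \<oplus>\<^bsub>S\<^esub> \<alpha> g \<zero>\<^bsub>S\<^esub> = \<alpha> g \<zero>\<^bsub>S\<^esub>"
    using \<alpha>_add[OF assms 0 0] by simp
  moreover have "\<alpha> g \<zero>\<^bsub>S\<^esub> \<in> carrier S"
    using \<alpha>_closed[OF assms 0] by simp
  ultimately show ?thesis
    by (metis S.add.l_cancel_one')
qed

lemma \<omega>_mem:
  assumes "g \<in> carrier G" "h \<in> carrier G"
  shows "\<omega> g h \<in> D g" "\<omega> g h \<in> D (g \<otimes>\<^bsub>G\<^esub> h)"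
proof -
  have "\<omega> g h \<in> carrier (prod_ideal_ring S (u g) (u (g \<otimes>\<^bsub>G\<^esub> h)))"
    using \<omega>_unit[OF assms] by (simp add: Units_def)
  then show "\<omega> g h \<in> D g" "\<omega> g h \<in> D (g \<otimes>\<^bsub>G\<^esub> h)"
    using S.ideal_prod_central_idempotents[OF u_central u_central, of g "g \<otimes>\<^bsub>G\<^esub> h"] assms
    by (simp_all add: prod_ideal_ring_def)
qed

lemma \<omega>_inverse:
  assumes "g \<in> carrier G" "h \<in> carrier G"
  obtains v where "v \<in> D g" "v \<in> D (g \<otimes>\<^bsub>G\<^esub> h)"
    "\<omega> g h \<otimes>\<^bsub>S\<^esub> v = u g \<otimes>\<^bsub>S\<^esub> u (g \<otimes>\<^bsub>G\<^esub> h)" "v \<otimes>\<^bsub>S\<^esub> \<omega> g h = u g \<otimes>\<^bsub>S\<^esub> u (g \<otimes>\<^bsub>G\<^esub> h)"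
proof -
  have "\<exists>v\<in>carrier (prod_ideal_ring S (u g) (u (g \<otimes>\<^bsub>G\<^esub> h))).
      v \<otimes>\<^bsub>S\<^esub> \<omega> g h = u g \<otimes>\<^bsub>S\<^esub> u (g \<otimes>\<^bsub>G\<^esub> h) \<and> \<omega> g h \<otimes>\<^bsub>S\<^esub> v = u g \<otimes>\<^bsub>S\<^esub> u (g \<otimes>\<^bsub>G\<^esub> h)"
    using \<omega>_unit[OF assms] unfolding Units_def by (simp add: prod_ideal_ring_def)
  then show thesis
    using S.ideal_prod_central_idempotents[OF u_central u_central, of g "g \<otimes>\<^bsub>G\<^esub> h"] assms that
    by (auto simp: prod_ideal_ring_def)
qed

text \<open>The element \<open>s \<delta>\<^sub>g\<close>.\<close>

definition mon :: "'s \<Rightarrow> 'g \<Rightarrow> 'g \<Rightarrow> 's" where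
  "mon s g = (\<lambda>h\<in>carrier G. if h = g then s else \<zero>\<^bsub>S\<^esub>)"

abbreviation C :: "('g \<Rightarrow> 's) ring" where "C \<equiv> partial_crossed_product G S u \<alpha> \<omega>"
abbreviation Cc :: "'g \<Rightarrow> ('g \<Rightarrow> 's) set" where "Cc \<equiv> partial_crossed_product_comp G S u \<alpha> \<omega>"

lemma Cc_eq:
  assumes g: "g \<in> carrier G"
  shows "Cc g = {mon s g |s. s \<in> D g}"
proof (intro equalityI subsetI)
  fix c assume "c \<in> Cc g"
  then have c: "c \<in> (\<Pi>\<^sub>E g\<in>carrier G. PIdl\<^bsub>S\<^esub> (u g))" "\<And>h. \<lbrakk>h \<in> carrier G; h \<noteq> g\<rbrakk> \<Longrightarrow> c h = \<zero>\<^bsub>S\<^esub>"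
    by (auto simp: partial_crossed_product_comp_def partial_crossed_product_def)
  then have "c g \<in> D g"
    using g PIdl_u[OF g] by blast
  moreover have "c = mon (c g) g"
    using c by (intro extensionalityI[of _ "carrier G"]) (auto simp: mon_def PiE_iff)
  ultimately show "c \<in> {mon s g |s. s \<in> D g}" by blast
next
  fix c assume "c \<in> {mon s g |s. s \<in> D g}"
  then obtain s where s: "c = mon s g" "s \<in> D g" by blast
  have "{h \<in> carrier G. mon s g h \<noteq> \<zero>\<^bsub>S\<^esub>} \<subseteq> {g}"
    by (auto simp: mon_def)
  then have "finite {h \<in> carrier G. mon s g h \<noteq> \<zero>\<^bsub>S\<^esub>}"
    using finite_subset by blast
  then show "c \<in> Cc g"
    using s by (auto simp: partial_crossed_product_comp_def partial_crossed_product_def mon_def PIdl_u)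
qed

lemma mon_mult:
  assumes g: "g \<in> carrier G" and h: "h \<in> carrier G" and s: "s \<in> D g" and t: "t \<in> D h"
  shows "mon s g \<otimes>\<^bsub>C\<^esub> mon t h =
    mon (s \<otimes>\<^bsub>S\<^esub> \<alpha> g (t \<otimes>\<^bsub>S\<^esub> u (inv\<^bsub>G\<^esub> g)) \<otimes>\<^bsub>S\<^esub> \<omega> g h) (g \<otimes>\<^bsub>G\<^esub> h)"
proof (rule extensionalityI[of _ "carrier G"])
  fix k assume k: "k \<in> carrier G"
  let ?F = "\<lambda>(g', h'). mon s g g' \<otimes>\<^bsub>S\<^esub> \<alpha> g' (mon t h h' \<otimes>\<^bsub>S\<^esub> u (inv\<^bsub>G\<^esub> g')) \<otimes>\<^bsub>S\<^esub> \<omega> g' h'"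
  let ?P = "{(g', h'). g' \<in> carrier G \<and> h' \<in> carrier G \<and> mon s g g' \<noteq> \<zero>\<^bsub>S\<^esub> \<and> mon t h h' \<noteq> \<zero>\<^bsub>S\<^esub> \<and>
    g' \<otimes>\<^bsub>G\<^esub> h' = k}"
  let ?z = "s \<otimes>\<^bsub>S\<^esub> \<alpha> g (t \<otimes>\<^bsub>S\<^esub> u (inv\<^bsub>G\<^esub> g)) \<otimes>\<^bsub>S\<^esub> \<omega> g h"
  have tu: "t \<otimes>\<^bsub>S\<^esub> u (inv\<^bsub>G\<^esub> g) \<in> D (inv\<^bsub>G\<^esub> g)"
    using t g by (simp add: S.m_assoc)
  have closed: "\<alpha> g (t \<otimes>\<^bsub>S\<^esub> u (inv\<^bsub>G\<^esub> g)) \<in> carrier S" "\<omega> g h \<in> carrier S"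
    using \<alpha>_closed[OF g tu] \<omega>_mem[OF g h] by auto
  have F: "?F (g, h) = ?z"
    using g h by (simp add: mon_def)
  have P: "?P = (if s \<noteq> \<zero>\<^bsub>S\<^esub> \<and> t \<noteq> \<zero>\<^bsub>S\<^esub> \<and> k = g \<otimes>\<^bsub>G\<^esub> h then {(g, h)} else {})"
    using g h by (auto simp: mon_def split: if_splits)
  \<comment> \<open>The multiplication sums over non-zero coefficients only. For a zero coefficient
    the sum is empty, so the claimed value has to vanish as well.\<close>
  have z: "?z = \<zero>\<^bsub>S\<^esub>" if "s = \<zero>\<^bsub>S\<^esub> \<or> t = \<zero>\<^bsub>S\<^esub>"
    using that closed s g by (auto simp: \<alpha>_zero)
  have "finsum S ?F ?P = (if k = g \<otimes>\<^bsub>G\<^esub> h then ?z else \<zero>\<^bsub>S\<^esub>)"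
  proof (cases "s \<noteq> \<zero>\<^bsub>S\<^esub> \<and> t \<noteq> \<zero>\<^bsub>S\<^esub> \<and> k = g \<otimes>\<^bsub>G\<^esub> h")
    case True
    then have "?P = {(g, h)}" using P by simp
    then show ?thesis
      unfolding \<open>?P = {(g, h)}\<close> using F closed s True by (subst S.finsum_insert) auto
  next
    case False
    then have "?P = {}" using P by simp
    then show ?thesis
      unfolding \<open>?P = {}\<close> using False z by auto
  qed
  then show "(mon s g \<otimes>\<^bsub>C\<^esub> mon t h) k = mon ?z (g \<otimes>\<^bsub>G\<^esub> h) k"
    using k by (simp add: partial_crossed_product_def mon_def)
qed (auto simp: partial_crossed_product_def mon_def)

text \<open>The idempotent \<open>u g\<close>, placed in degree one, plays the part of
  \<open>\<epsilon> g\<close> in the partial crossed product.\<close>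

lemma mon_u_left:
  assumes "g \<in> carrier G" "s \<in> D g"
  shows "mon (u g) \<one>\<^bsub>G\<^esub> \<otimes>\<^bsub>C\<^esub> mon s g = mon s g"
  using assms by (simp add: mon_mult \<alpha>_one \<omega>_one u_comm S.m_assoc)

lemma mon_u_right:
  assumes "g \<in> carrier G" "s \<in> D g"
  shows "mon s g \<otimes>\<^bsub>C\<^esub> mon (u (inv\<^bsub>G\<^esub> g)) \<one>\<^bsub>G\<^esub> = mon s g"
  using assms by (simp add: mon_mult \<alpha>_unit \<omega>_one S.m_assoc)

text \<open>The cocycle identity for \<open>g, g\<^sup>-\<^sup>1, g\<close> gives \<open>\<alpha>\<^sub>g(\<omega>\<^sub>h\<^sub>,\<^sub>g) = \<omega>\<^sub>g\<^sub>,\<^sub>h\<close> for the inverse \<open>h\<close> of \<open>g\<close>, so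
  the same element inverts \<open>1\<^sub>g \<delta>\<^sub>g\<close> from both sides.\<close>

lemma mon_u_inverse:
  assumes g: "g \<in> carrier G"
  shows "\<exists>v\<in>D (inv\<^bsub>G\<^esub> g). mon (u g) g \<otimes>\<^bsub>C\<^esub> mon v (inv\<^bsub>G\<^esub> g) = mon (u g) \<one>\<^bsub>G\<^esub> \<and>
    mon v (inv\<^bsub>G\<^esub> g) \<otimes>\<^bsub>C\<^esub> mon (u g) g = mon (u (inv\<^bsub>G\<^esub> g)) \<one>\<^bsub>G\<^esub>"
proof -
  let ?h = "inv\<^bsub>G\<^esub> g"
  have h: "?h \<in> carrier G" using g by simp
  \<comment> \<open>The product of \<open>?h\<close> and \<open>g\<close> is neutral, so
    \<open>\<omega> ?h g\<close> is a unit of the ring \<open>D ?h\<close>. Its inverse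
    \<open>v\<close> becomes the coefficient of the inverse of \<open>mon (u g) g\<close>.\<close>
  obtain v where v: "v \<in> D ?h" "\<omega> ?h g \<otimes>\<^bsub>S\<^esub> v = u ?h" "v \<otimes>\<^bsub>S\<^esub> \<omega> ?h g = u ?h"
    using \<omega>_inverse[OF h g] g by auto
  have w: "\<omega> ?h g \<in> D ?h" "\<omega> g ?h \<in> D g"
    using \<omega>_mem g h by auto
  have \<alpha>w: "\<alpha> g (\<omega> ?h g) \<in> D g" "\<alpha> g v \<in> D g"
    using \<alpha>_closed[OF g] w v by blast+
  have "\<alpha> g (\<omega> ?h g) \<otimes>\<^bsub>S\<^esub> u g = \<omega> g ?h \<otimes>\<^bsub>S\<^esub> u g"
    using \<omega>_cocycle[OF g h g] w(1) g by (simp add: \<omega>_one)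
  then have \<alpha>_\<omega>: "\<alpha> g (\<omega> ?h g) = \<omega> g ?h"
    using \<alpha>w w(2) by simp
  have "\<alpha> g v \<otimes>\<^bsub>S\<^esub> \<omega> g ?h = u g"
    using \<alpha>_mult[OF g v(1) w(1)] v(3) \<alpha>_unit[OF g] \<alpha>_\<omega> by simp
  moreover have "u g \<otimes>\<^bsub>S\<^esub> \<alpha> g v = \<alpha> g v"
    using \<alpha>w g by (simp add: u_comm)
  ultimately have 1: "mon (u g) g \<otimes>\<^bsub>C\<^esub> mon v ?h = mon (u g) \<one>\<^bsub>G\<^esub>"
    using g h v(1) by (simp add: mon_mult)
  have "\<alpha> ?h (u g) = u ?h"
    using \<alpha>_unit[OF h] g by simp
  then have 2: "mon v ?h \<otimes>\<^bsub>C\<^esub> mon (u g) g = mon (u ?h) \<one>\<^bsub>G\<^esub>"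
    using g h v by (simp add: mon_mult)
  show ?thesis
    using v(1) 1 2 by blast
qed

end

text \<open>The family \<epsilon> is constructed here: it consists of the products
  \<open>a g \<otimes> b g\<close> of preimages of an inverse pair in the partial crossed product.
  Its identities are checked after applying the injective \<open>\<phi>\<close>.\<close>

lemma (in graded) epsilon_crossed_product_if_partial:
  assumes P: "unital_twisted_partial_action G S u \<alpha> \<omega>"
    and \<phi>: "\<phi> \<in> graded_iso G B Bc (partial_crossed_product G S u \<alpha> \<omega>)
      (partial_crossed_product_comp G S u \<alpha> \<omega>)"
  shows "epsilon_crossed_product G B Bc"
proof -
  interpret P: unital_twisted_partial_action G S u \<alpha> \<omega>
    by (rule P)
  have iso: "\<phi> \<in> ring_iso B P.C" and \<phi>_comp: "\<And>g. g \<in> carrier G \<Longrightarrow> \<phi> ` Bc g = {P.mon s g |s. s \<in> P.D g}"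
    using \<phi> P.Cc_eq by (auto simp: graded_iso_def)
  have mult: "\<And>x y. \<lbrakk>x \<in> carrier B; y \<in> carrier B\<rbrakk> \<Longrightarrow> \<phi> (x \<otimes> y) = \<phi> x \<otimes>\<^bsub>P.C\<^esub> \<phi> y"
    using iso by (simp add: ring_iso_def ring_hom_mult)
  have inj: "\<And>x y. \<lbrakk>\<phi> x = \<phi> y; x \<in> carrier B; y \<in> carrier B\<rbrakk> \<Longrightarrow> x = y"
    using iso by (auto simp: ring_iso_def bij_betw_def inj_on_def)
  have "\<exists>a b. a \<in> Bc g \<and> b \<in> Bc (g\<acute>) \<and> \<phi> (a \<otimes> b) = P.mon (u g) \<e> \<and> \<phi> (b \<otimes> a) = P.mon (u (g\<acute>)) \<e>"
    if g: "g \<in> carrier G" for g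
  proof -
    have g': "g\<acute> \<in> carrier G" using g by simp
    obtain v where v: "v \<in> P.D (g\<acute>)" "P.mon (u g) g \<otimes>\<^bsub>P.C\<^esub> P.mon v (g\<acute>) = P.mon (u g) \<e>"
      "P.mon v (g\<acute>) \<otimes>\<^bsub>P.C\<^esub> P.mon (u g) g = P.mon (u (g\<acute>)) \<e>"
      using P.mon_u_inverse[OF g] by blast
    have "P.mon (u g) g \<in> \<phi> ` Bc g" "P.mon v (g\<acute>) \<in> \<phi> ` Bc (g\<acute>)"
      using \<phi>_comp[OF g] \<phi>_comp[OF g'] v(1) g P.u_props[OF g] by blast+
    then obtain a b where ab: "a \<in> Bc g" "\<phi> a = P.mon (u g) g" "b \<in> Bc (g\<acute>)" "\<phi> b = P.mon v (g\<acute>)"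
      by (metis imageE)
    then have "a \<in> carrier B" "b \<in> carrier B"
      using g g' comp_carrier by blast+
    then show ?thesis
      using ab v mult by (intro exI[of _ a] exI[of _ b]) simp
  qed
  then obtain a b where a: "\<And>g. g \<in> carrier G \<Longrightarrow> a g \<in> Bc g" and b: "\<And>g. g \<in> carrier G \<Longrightarrow> b g \<in> Bc (g\<acute>)"
    and ab: "\<And>g. g \<in> carrier G \<Longrightarrow> \<phi> (a g \<otimes> b g) = P.mon (u g) \<e>"
    and ba: "\<And>g. g \<in> carrier G \<Longrightarrow> \<phi> (b g \<otimes> a g) = P.mon (u (g\<acute>)) \<e>"
    by metis
  have abc: "a g \<in> carrier B" "b g \<in> carrier B" if "g \<in> carrier G" for g
    using comp_carrier[OF a] comp_carrier[OF b] that by simp_all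
  let ?\<epsilon> = "\<lambda>g. a g \<otimes> b g"
  have "?\<epsilon> g \<otimes> x = x" "x \<otimes> ?\<epsilon> (g\<acute>) = x" if x: "x \<in> Bc g" and g: "g \<in> carrier G" for x g
  proof -
    have g': "g\<acute> \<in> carrier G" using g by simp
    have xc: "x \<in> carrier B" using x g comp_carrier by blast
    obtain s where s: "s \<in> P.D g" "\<phi> x = P.mon s g"
      using \<phi>_comp[OF g] x by blast
    have "\<phi> (?\<epsilon> g \<otimes> x) = \<phi> x"
      using abc[OF g] xc ab[OF g] P.mon_u_left[OF g s(1)] by (simp add: mult[of "?\<epsilon> g"] s(2) del: m_assoc)
    then show "?\<epsilon> g \<otimes> x = x"
      using inj abc[OF g] xc by simp
    have "\<phi> (x \<otimes> ?\<epsilon> (g\<acute>)) = \<phi> x"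
      using abc[OF g'] xc ab[OF g'] P.mon_u_right[OF g s(1)] by (simp add: mult[of x "?\<epsilon> (g\<acute>)"] s(2))
    then show "x \<otimes> ?\<epsilon> (g\<acute>) = x"
      using inj abc[OF g'] xc by simp
  qed
  then have "epsilon_family G B Bc ?\<epsilon>"
    unfolding epsilon_family_def using a b by (auto intro: ideal_prod.prod)
  \<comment> \<open>Both sides are sent by \<open>\<phi>\<close> to \<open>u (g\<acute>)\<close>
    placed in degree one.\<close>
  moreover have "b g \<otimes> a g = ?\<epsilon> (g\<acute>)" if g: "g \<in> carrier G" for g
    using inj[of "b g \<otimes> a g" "?\<epsilon> (g\<acute>)"] ba[OF g] ab[of "g\<acute>"] abc[OF g] abc[of "g\<acute>"] g by simp
  ultimately show ?thesis
    unfolding epsilon_crossed_product_def using graded_ring_axioms a b by blast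
qed


section \<open>Matrix rings over graded rings\<close>

lemma mat_set_index: "\<lbrakk>M \<in> mat_set n V; i < n; j < n\<rbrakk> \<Longrightarrow> M $$ (i, j) \<in> V"
  by (simp add: mat_set_def)

lemma mat_mem_mat_set: "mat n n f \<in> mat_set n V \<longleftrightarrow> (\<forall>i<n. \<forall>j<n. f (i, j) \<in> V)"
  by (simp add: mat_set_def)

lemma mat_set_eqI:
  assumes "M \<in> mat_set n V" "N \<in> mat_set n W" "\<And>i j. \<lbrakk>i < n; j < n\<rbrakk> \<Longrightarrow> M $$ (i, j) = N $$ (i, j)"
  shows "M = N"
  using assms by (intro eq_matI) (auto simp: mat_set_def)

lemma mat_set_mono: "V \<subseteq> W \<Longrightarrow> mat_set n V \<subseteq> mat_set n W"
  unfolding mat_set_def by blast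

lemma matrix_ring_simps:
  "carrier (matrix_ring n R) = mat_set n (carrier R)"
  "\<zero>\<^bsub>matrix_ring n R\<^esub> = mat n n (\<lambda>_. \<zero>\<^bsub>R\<^esub>)"
  "\<one>\<^bsub>matrix_ring n R\<^esub> = mat n n (\<lambda>(i, j). if i = j then \<one>\<^bsub>R\<^esub> else \<zero>\<^bsub>R\<^esub>)"
  "M \<oplus>\<^bsub>matrix_ring n R\<^esub> N = mat n n (\<lambda>(i, j). M $$ (i, j) \<oplus>\<^bsub>R\<^esub> N $$ (i, j))"
  "M \<otimes>\<^bsub>matrix_ring n R\<^esub> N = mat n n (\<lambda>(i, j). \<Oplus>\<^bsub>R\<^esub>k\<in>{..<n}. M $$ (i, k) \<otimes>\<^bsub>R\<^esub> N $$ (k, j))"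
  by (simp_all add: matrix_ring_def)

lemma matrix_ring_index:
  assumes "i < n" "j < n"
  shows "(M \<oplus>\<^bsub>matrix_ring n R\<^esub> N) $$ (i, j) = M $$ (i, j) \<oplus>\<^bsub>R\<^esub> N $$ (i, j)"
    "(M \<otimes>\<^bsub>matrix_ring n R\<^esub> N) $$ (i, j) = (\<Oplus>\<^bsub>R\<^esub>k\<in>{..<n}. M $$ (i, k) \<otimes>\<^bsub>R\<^esub> N $$ (k, j))"
  using assms by (simp_all add: matrix_ring_simps)

lemma matrix_ring_dim:
  "dim_row (M \<oplus>\<^bsub>matrix_ring n R\<^esub> N) = n" "dim_col (M \<oplus>\<^bsub>matrix_ring n R\<^esub> N) = n"
  "dim_row (M \<otimes>\<^bsub>matrix_ring n R\<^esub> N) = n" "dim_col (M \<otimes>\<^bsub>matrix_ring n R\<^esub> N) = n"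
  by (simp_all add: matrix_ring_simps)

lemma mat_set_dim: "M \<in> mat_set n V \<Longrightarrow> dim_row M = n" "M \<in> mat_set n V \<Longrightarrow> dim_col M = n"
  by (auto simp: mat_set_def)

definition scalar_matrix :: "nat \<Rightarrow> ('a, 'm) ring_scheme \<Rightarrow> 'a \<Rightarrow> 'a mat" where
  "scalar_matrix n R x = mat n n (\<lambda>(i, j). if i = j then x else \<zero>\<^bsub>R\<^esub>)"

section \<open>The ring of matrices over a ring\<close>

context ring
begin

lemma finsum_delta_left:
  assumes "i < n" "x \<in> carrier R" "f \<in> {..<n} \<rightarrow> carrier R"
  shows "(\<Oplus>k\<in>{..<n::nat}. (if i = k then x else \<zero>) \<otimes> f k) = x \<otimes> f i"
proof -
  have f: "f k \<in> carrier R" if "k < n" for k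
    using that assms(3) by blast
  have "(\<Oplus>k\<in>{..<n}. (if i = k then x else \<zero>) \<otimes> f k) = (\<Oplus>k\<in>{..<n}. if i = k then x \<otimes> f k else \<zero>)"
    using assms f by (intro finsum_cong') auto
  also have "\<dots> = x \<otimes> f i"
    using assms f by (intro finsum_singleton) auto
  finally show ?thesis .
qed

lemma finsum_delta_right:
  assumes "j < n" "x \<in> carrier R" "f \<in> {..<n} \<rightarrow> carrier R"
  shows "(\<Oplus>k\<in>{..<n::nat}. f k \<otimes> (if k = j then x else \<zero>)) = f j \<otimes> x"
proof -
  have f: "f k \<in> carrier R" if "k < n" for k
    using that assms(3) by blast
  have "(\<Oplus>k\<in>{..<n}. f k \<otimes> (if k = j then x else \<zero>)) = (\<Oplus>k\<in>{..<n}. if j = k then f k \<otimes> x else \<zero>)"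
    using assms f by (intro finsum_cong') auto
  also have "\<dots> = f j \<otimes> x"
    using assms f by (intro finsum_singleton) auto
  finally show ?thesis .
qed

lemma scalar_matrix_mult_left:
  assumes "M \<in> mat_set n (carrier R)" "x \<in> carrier R" "i < n" "j < n"
  shows "(scalar_matrix n R x \<otimes>\<^bsub>matrix_ring n R\<^esub> M) $$ (i, j) = x \<otimes> M $$ (i, j)"
proof -
  have "(\<Oplus>k\<in>{..<n}. scalar_matrix n R x $$ (i, k) \<otimes> M $$ (k, j)) =
      (\<Oplus>k\<in>{..<n}. (if i = k then x else \<zero>) \<otimes> M $$ (k, j))"
    using assms mat_set_index[OF assms(1)] by (intro finsum_cong') (auto simp: scalar_matrix_def)
  also have "\<dots> = x \<otimes> M $$ (i, j)"
    using assms mat_set_index[OF assms(1)] by (intro finsum_delta_left) auto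
  finally show ?thesis
    using assms by (simp add: matrix_ring_simps)
qed

lemma scalar_matrix_mult_right:
  assumes "M \<in> mat_set n (carrier R)" "x \<in> carrier R" "i < n" "j < n"
  shows "(M \<otimes>\<^bsub>matrix_ring n R\<^esub> scalar_matrix n R x) $$ (i, j) = M $$ (i, j) \<otimes> x"
proof -
  have "(\<Oplus>k\<in>{..<n}. M $$ (i, k) \<otimes> scalar_matrix n R x $$ (k, j)) =
      (\<Oplus>k\<in>{..<n}. M $$ (i, k) \<otimes> (if k = j then x else \<zero>))"
    using assms mat_set_index[OF assms(1)] by (intro finsum_cong') (auto simp: scalar_matrix_def)
  also have "\<dots> = M $$ (i, j) \<otimes> x"
    using assms mat_set_index[OF assms(1)] by (intro finsum_delta_right) auto
  finally show ?thesis
    using assms by (simp add: matrix_ring_simps)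
qed

lemma one_matrix_ring: "\<one>\<^bsub>matrix_ring n R\<^esub> = scalar_matrix n R \<one>"
  by (simp add: matrix_ring_simps scalar_matrix_def)

lemma matrix_mult_closed:
  assumes "M \<in> mat_set n (carrier R)" "N \<in> mat_set n (carrier R)"
  shows "M \<otimes>\<^bsub>matrix_ring n R\<^esub> N \<in> mat_set n (carrier R)"
  using mat_set_index[OF assms(1)] mat_set_index[OF assms(2)]
  by (auto simp: matrix_ring_simps mat_mem_mat_set intro!: finsum_closed)

lemma matrix_mult_assoc:
  assumes "M \<in> mat_set n (carrier R)" "N \<in> mat_set n (carrier R)" "P \<in> mat_set n (carrier R)"
  shows "M \<otimes>\<^bsub>matrix_ring n R\<^esub> N \<otimes>\<^bsub>matrix_ring n R\<^esub> P = M \<otimes>\<^bsub>matrix_ring n R\<^esub> (N \<otimes>\<^bsub>matrix_ring n R\<^esub> P)"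
proof (rule mat_set_eqI)
  show "M \<otimes>\<^bsub>matrix_ring n R\<^esub> N \<otimes>\<^bsub>matrix_ring n R\<^esub> P \<in> mat_set n (carrier R)"
    "M \<otimes>\<^bsub>matrix_ring n R\<^esub> (N \<otimes>\<^bsub>matrix_ring n R\<^esub> P) \<in> mat_set n (carrier R)"
    using assms by (auto intro!: matrix_mult_closed)
  fix i j assume i: "i < n" and j: "j < n"
  have M: "M $$ (i, l) \<in> carrier R" if "l < n" for l
    using mat_set_index[OF assms(1) i that] .
  have N: "N $$ (l, k) \<in> carrier R" if "l < n" "k < n" for l k
    using mat_set_index[OF assms(2) that] .
  have P: "P $$ (k, j) \<in> carrier R" if "k < n" for k
    using mat_set_index[OF assms(3) that j] .
  have "(\<Oplus>k\<in>{..<n}. (M \<otimes>\<^bsub>matrix_ring n R\<^esub> N) $$ (i, k) \<otimes> P $$ (k, j)) =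
      (\<Oplus>k\<in>{..<n}. (\<Oplus>l\<in>{..<n}. M $$ (i, l) \<otimes> N $$ (l, k)) \<otimes> P $$ (k, j))"
    using i M N P by (intro finsum_cong') (auto simp: matrix_ring_index intro!: finsum_closed)
  also have "\<dots> =
      (\<Oplus>k\<in>{..<n}. \<Oplus>l\<in>{..<n}. M $$ (i, l) \<otimes> N $$ (l, k) \<otimes> P $$ (k, j))"
    using M N P by (intro finsum_cong' finsum_ldistr) (auto intro!: finsum_closed)
  also have "\<dots> = (\<Oplus>l\<in>{..<n}. \<Oplus>k\<in>{..<n}. M $$ (i, l) \<otimes> N $$ (l, k) \<otimes> P $$ (k, j))"
    using M N P by (intro finsum_swap) auto
  also have "\<dots> = (\<Oplus>l\<in>{..<n}. M $$ (i, l) \<otimes> (\<Oplus>k\<in>{..<n}. N $$ (l, k) \<otimes> P $$ (k, j)))"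
  proof (rule finsum_cong')
    fix l assume "l \<in> {..<n}"
    then show "(\<Oplus>k\<in>{..<n}. M $$ (i, l) \<otimes> N $$ (l, k) \<otimes> P $$ (k, j)) =
        M $$ (i, l) \<otimes> (\<Oplus>k\<in>{..<n}. N $$ (l, k) \<otimes> P $$ (k, j))"
      using M N P by (subst finsum_rdistr) (auto intro!: finsum_cong' simp: m_assoc)
  qed (use M N P in \<open>auto intro!: finsum_closed\<close>)
  also have "\<dots> = (\<Oplus>l\<in>{..<n}. M $$ (i, l) \<otimes> (N \<otimes>\<^bsub>matrix_ring n R\<^esub> P) $$ (l, j))"
    using j M N P by (intro finsum_cong') (auto simp: matrix_ring_index intro!: finsum_closed)
  finally show "(M \<otimes>\<^bsub>matrix_ring n R\<^esub> N \<otimes>\<^bsub>matrix_ring n R\<^esub> P) $$ (i, j) =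
      (M \<otimes>\<^bsub>matrix_ring n R\<^esub> (N \<otimes>\<^bsub>matrix_ring n R\<^esub> P)) $$ (i, j)"
    using i j by (simp add: matrix_ring_index(2))
qed

lemma ring_matrix_ring: "ring (matrix_ring n R)"
proof (rule ringI)
  show "abelian_group (matrix_ring n R)"
  proof (rule abelian_groupI)
    fix M assume M: "M \<in> carrier (matrix_ring n R)"
    then show "\<exists>N\<in>carrier (matrix_ring n R). N \<oplus>\<^bsub>matrix_ring n R\<^esub> M = \<zero>\<^bsub>matrix_ring n R\<^esub>"
      by (intro bexI[of _ "mat n n (\<lambda>ij. \<ominus> M $$ ij)"] eq_matI)
        (auto simp: matrix_ring_simps mat_mem_mat_set mat_set_index l_neg)
  qed (auto simp: matrix_ring_simps mat_mem_mat_set mat_set_index mat_set_dim a_assoc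
      intro!: eq_matI a_comm)
  show "Group.monoid (matrix_ring n R)"
  proof (rule monoidI)
    fix M assume M: "M \<in> carrier (matrix_ring n R)"
    then have M': "M \<in> mat_set n (carrier R)"
      by (simp add: matrix_ring_simps)
    have one: "\<one>\<^bsub>matrix_ring n R\<^esub> \<in> mat_set n (carrier R)"
      by (simp add: matrix_ring_simps mat_mem_mat_set)
    show "\<one>\<^bsub>matrix_ring n R\<^esub> \<otimes>\<^bsub>matrix_ring n R\<^esub> M = M"
      using M' matrix_mult_closed[OF one M'] mat_set_index[OF M']
      by (intro mat_set_eqI) (auto simp: one_matrix_ring scalar_matrix_mult_left)
    show "M \<otimes>\<^bsub>matrix_ring n R\<^esub> \<one>\<^bsub>matrix_ring n R\<^esub> = M"
      using M' matrix_mult_closed[OF M' one] mat_set_index[OF M']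
      by (intro mat_set_eqI) (auto simp: one_matrix_ring scalar_matrix_mult_right)
  next
    fix M N P assume "M \<in> carrier (matrix_ring n R)" "N \<in> carrier (matrix_ring n R)"
      "P \<in> carrier (matrix_ring n R)"
    then show "M \<otimes>\<^bsub>matrix_ring n R\<^esub> N \<in> carrier (matrix_ring n R)"
      "M \<otimes>\<^bsub>matrix_ring n R\<^esub> N \<otimes>\<^bsub>matrix_ring n R\<^esub> P = M \<otimes>\<^bsub>matrix_ring n R\<^esub> (N \<otimes>\<^bsub>matrix_ring n R\<^esub> P)"
      using matrix_mult_closed[of M n N] matrix_mult_assoc[of M n N P]
      unfolding matrix_ring_simps(1) by blast+
  qed (simp add: matrix_ring_simps mat_mem_mat_set)
next
  fix M N P
  assume "M \<in> carrier (matrix_ring n R)" "N \<in> carrier (matrix_ring n R)" "P \<in> carrier (matrix_ring n R)"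
  then have MNP: "M $$ (i, j) \<in> carrier R" "N $$ (i, j) \<in> carrier R" "P $$ (i, j) \<in> carrier R"
    if "i < n" "j < n" for i j
    using that by (auto simp: matrix_ring_simps mat_set_index)
  have "(\<Oplus>k\<in>{..<n}. (M \<oplus>\<^bsub>matrix_ring n R\<^esub> N) $$ (i, k) \<otimes> P $$ (k, j)) =
      (\<Oplus>k\<in>{..<n}. M $$ (i, k) \<otimes> P $$ (k, j)) \<oplus> (\<Oplus>k\<in>{..<n}. N $$ (i, k) \<otimes> P $$ (k, j))"
    if "i < n" "j < n" for i j
    using MNP that by (intro trans[OF finsum_cong' finsum_addf]) (auto simp: matrix_ring_index l_distr)
  then show "(M \<oplus>\<^bsub>matrix_ring n R\<^esub> N) \<otimes>\<^bsub>matrix_ring n R\<^esub> P =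
      M \<otimes>\<^bsub>matrix_ring n R\<^esub> P \<oplus>\<^bsub>matrix_ring n R\<^esub> N \<otimes>\<^bsub>matrix_ring n R\<^esub> P"
    by (intro eq_matI) (simp_all add: matrix_ring_index matrix_ring_dim)
  have "(\<Oplus>k\<in>{..<n}. P $$ (i, k) \<otimes> (M \<oplus>\<^bsub>matrix_ring n R\<^esub> N) $$ (k, j)) =
      (\<Oplus>k\<in>{..<n}. P $$ (i, k) \<otimes> M $$ (k, j)) \<oplus> (\<Oplus>k\<in>{..<n}. P $$ (i, k) \<otimes> N $$ (k, j))"
    if "i < n" "j < n" for i j
    using MNP that by (intro trans[OF finsum_cong' finsum_addf]) (auto simp: matrix_ring_index r_distr)
  then show "P \<otimes>\<^bsub>matrix_ring n R\<^esub> (M \<oplus>\<^bsub>matrix_ring n R\<^esub> N) =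
      P \<otimes>\<^bsub>matrix_ring n R\<^esub> M \<oplus>\<^bsub>matrix_ring n R\<^esub> P \<otimes>\<^bsub>matrix_ring n R\<^esub> N"
    by (intro eq_matI) (simp_all add: matrix_ring_index matrix_ring_dim)
qed

text \<open>Reduces the decomposition of a matrix into homogeneous matrices to decompositions of its
  entries.\<close>

lemma finsum_matrix_ring_index:
  assumes "finite I" "f \<in> I \<rightarrow> mat_set n (carrier R)" "i < n" "j < n"
  shows "finsum (matrix_ring n R) f I $$ (i, j) = (\<Oplus>x\<in>I. f x $$ (i, j))"
proof -
  interpret M: ring "matrix_ring n R"
    by (rule ring_matrix_ring)
  show ?thesis
    using assms(1,2)
  proof (induction I rule: finite_induct)
    case empty
    then show ?case using assms by (simp add: matrix_ring_simps)
  next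
    case (insert x F)
    then have "f x $$ (i, j) \<in> carrier R" "(\<lambda>x. f x $$ (i, j)) \<in> F \<rightarrow> carrier R"
      using assms mat_set_index by blast+
    moreover have "f \<in> F \<rightarrow> carrier (matrix_ring n R)" "f x \<in> carrier (matrix_ring n R)"
      using insert.prems by (auto simp: matrix_ring_simps)
    ultimately show ?case
      using insert assms by (simp add: matrix_ring_simps(4))
  qed
qed

end

section \<open>The grading of the matrix ring\<close>

context graded
begin

lemma mat_comp_carrier: "\<lbrakk>M \<in> mat_set n (Bc g); g \<in> carrier G\<rbrakk> \<Longrightarrow> M \<in> mat_set n (carrier B)"
  using mat_set_mono[of "Bc g" "carrier B"] comp_carrier by blast

lemma graded_matrix_ring: "graded G (matrix_ring n B) (\<lambda>g. mat_set n (Bc g))"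
proof -
  interpret M: ring "matrix_ring n B"
    by (rule ring_matrix_ring)
  have "graded_ring G (matrix_ring n B) (\<lambda>g. mat_set n (Bc g))"
  proof (rule graded_ring.intro[OF G.group_axioms M.ring_axioms], rule graded_ring_axioms.intro, goal_cases)
    case (1 g)
    then have sub: "mat_set n (Bc g) \<subseteq> carrier (matrix_ring n B)"
      using mat_comp_carrier by (auto simp: matrix_ring_simps)
    have neg: "\<ominus>\<^bsub>matrix_ring n B\<^esub> N \<in> mat_set n (Bc g)" if N: "N \<in> mat_set n (Bc g)" for N
    proof -
      let ?N = "mat n n (\<lambda>ij. \<ominus> N $$ ij)"
      have mem: "?N \<in> mat_set n (Bc g)"
        using 1 N by (auto simp: mat_mem_mat_set mat_set_index comp_neg)
      have "?N \<oplus>\<^bsub>matrix_ring n B\<^esub> N = \<zero>\<^bsub>matrix_ring n B\<^esub>"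
        using mat_set_index[OF N] comp_carrier[OF _ 1] by (intro eq_matI) (auto simp: matrix_ring_simps l_neg)
      then have "\<ominus>\<^bsub>matrix_ring n B\<^esub> N = ?N"
        using N mem sub by (intro M.minus_equality) auto
      then show ?thesis using mem by simp
    qed
    show ?case
    proof (rule additive_subgroupI, rule subgroup.intro, goal_cases)
      case 1
      then show ?case using sub by simp
    next
      case (2 M N)
      then show ?case
        using comp_add[OF _ _ \<open>g \<in> carrier G\<close>] by (auto simp: matrix_ring_simps mat_mem_mat_set mat_set_index)
    next
      case 3
      then show ?case
        using comp_zero[OF \<open>g \<in> carrier G\<close>] by (simp add: matrix_ring_simps mat_mem_mat_set)
    next
      case (4 N)
      then show ?case using neg by (simp add: a_inv_def)
    qed
  next
    case (2 N)
    then have N: "N $$ (i, j) \<in> carrier B" if "i < n" "j < n" for i j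
      using that by (auto simp: matrix_ring_simps mat_set_index)
    let ?c = "\<lambda>g\<in>carrier G. mat n n (\<lambda>ij. part (N $$ ij) g)"
    let ?supp = "\<lambda>c. {g \<in> carrier G. c g \<noteq> \<zero>\<^bsub>matrix_ring n B\<^esub>}"
    have c_mem: "?c \<in> (\<Pi>\<^sub>E g\<in>carrier G. mat_set n (Bc g))"
      using N by (auto simp: mat_mem_mat_set part_closed)
    \<comment> \<open>A non-zero matrix has a non-zero entry, so the support lies in the union of
      the finitely many finite supports of the entries.\<close>
    have sub: "?supp ?c \<subseteq> (\<Union>i\<in>{..<n}. \<Union>j\<in>{..<n}. supp (N $$ (i, j)))"
    proof
      fix g assume g: "g \<in> ?supp ?c"
      then have "mat n n (\<lambda>ij. part (N $$ ij) g) \<noteq> mat n n (\<lambda>_. \<zero>)"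
        by (auto simp: matrix_ring_simps)
      then obtain i j where "i < n" "j < n" "part (N $$ (i, j)) g \<noteq> \<zero>"
        by (auto simp: mat_eq_iff)
      then show "g \<in> (\<Union>i\<in>{..<n}. \<Union>j\<in>{..<n}. supp (N $$ (i, j)))"
        using g by blast
    qed
    have fin: "finite (?supp ?c)"
      by (rule finite_subset[OF sub]) (use N part_props(2) in auto)
    \<comment> \<open>Allows every entry to be expanded over the one common support of
      \<open>?c\<close>.\<close>
    have sup: "supp (N $$ (i, j)) \<subseteq> ?supp ?c" if "i < n" "j < n" for i j
    proof
      fix g assume g: "g \<in> supp (N $$ (i, j))"
      then have "?c g $$ (i, j) \<noteq> \<zero>\<^bsub>matrix_ring n B\<^esub> $$ (i, j)"
        using that by (simp add: matrix_ring_simps)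
      then have "?c g \<noteq> \<zero>\<^bsub>matrix_ring n B\<^esub>" by metis
      then show "g \<in> ?supp ?c" using g by blast
    qed
    have mem: "d g \<in> mat_set n (carrier B)"
      if "d \<in> (\<Pi>\<^sub>E g\<in>carrier G. mat_set n (Bc g))" "g \<in> carrier G" for d g
      by (rule mat_comp_carrier[OF PiE_mem[OF that] that(2)])
    have entry: "finsum (matrix_ring n B) d F $$ (i, j) = (\<Oplus>g\<in>F. d g $$ (i, j))"
      if "d \<in> (\<Pi>\<^sub>E g\<in>carrier G. mat_set n (Bc g))" "finite F" "F \<subseteq> carrier G" "i < n" "j < n" for d F i j
      using that mem[OF that(1)] by (intro finsum_matrix_ring_index) auto
    have closed: "finsum (matrix_ring n B) d F \<in> mat_set n (carrier B)"
      if "d \<in> (\<Pi>\<^sub>E g\<in>carrier G. mat_set n (Bc g))" "F \<subseteq> carrier G" for d F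
    proof -
      have "d \<in> F \<rightarrow> carrier (matrix_ring n B)"
        using that mem[OF that(1)] by (auto simp: matrix_ring_simps)
      then show ?thesis
        using M.finsum_closed by (simp add: matrix_ring_simps)
    qed
    have sum: "N = finsum (matrix_ring n B) ?c (?supp ?c)"
    proof (rule mat_set_eqI)
      show "N \<in> mat_set n (carrier B)"
        using 2 by (simp add: matrix_ring_simps)
      show "finsum (matrix_ring n B) ?c (?supp ?c) \<in> mat_set n (carrier B)"
        by (rule closed[OF c_mem]) auto
      fix i j assume ij: "i < n" "j < n"
      have "finsum (matrix_ring n B) ?c (?supp ?c) $$ (i, j) = (\<Oplus>g\<in>?supp ?c. ?c g $$ (i, j))"
        using ij fin by (intro entry[OF c_mem]) auto
      also have "\<dots> = (\<Oplus>g\<in>?supp ?c. part (N $$ (i, j)) g)"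
        using ij N by (intro finsum_cong') auto
      also have "\<dots> = N $$ (i, j)"
        using ij N fin sup by (intro sum_parts) auto
      finally show "N $$ (i, j) = finsum (matrix_ring n B) ?c (?supp ?c) $$ (i, j)" ..
    qed
    show ?case
    proof (rule ex1I[of _ ?c])
      show "?c \<in> (\<Pi>\<^sub>E g\<in>carrier G. mat_set n (Bc g)) \<and> finite (?supp ?c) \<and>
          N = finsum (matrix_ring n B) ?c (?supp ?c)"
        using c_mem fin sum by blast
      fix d assume d: "d \<in> (\<Pi>\<^sub>E g\<in>carrier G. mat_set n (Bc g)) \<and> finite (?supp d) \<and>
          N = finsum (matrix_ring n B) d (?supp d)"
      show "d = ?c"
      proof (rule PiE_ext)
        show "d \<in> (\<Pi>\<^sub>E g\<in>carrier G. mat_set n (Bc g))" "?c \<in> (\<Pi>\<^sub>E g\<in>carrier G. mat_set n (Bc g))"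
          using d c_mem by auto
        fix h assume h: "h \<in> carrier G"
        have dm: "d g \<in> mat_set n (Bc g)" if "g \<in> carrier G" for g
          using d that by (auto dest: PiE_mem)
        show "d h = ?c h"
        proof (rule mat_set_eqI[OF dm[OF h]])
          show "?c h \<in> mat_set n (Bc h)"
            using c_mem h by (auto dest: PiE_mem)
          fix i j assume ij: "i < n" "j < n"
          \<comment> \<open>The entries of a competing decomposition \<open>d\<close> are
            homogeneous, which forces them to be the parts of the entries of
            \<open>N\<close>.\<close>
          have "N $$ (i, j) = (\<Oplus>g\<in>?supp d. d g $$ (i, j))"
            using d ij entry[of d "?supp d" i j] by auto
          then have "part (N $$ (i, j)) h = part (\<Oplus>g\<in>?supp d. d g $$ (i, j)) h"
            by simp
          also have "\<dots> = (if h \<in> ?supp d then d h $$ (i, j) else \<zero>)"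
            using d h ij mat_set_index[OF dm] by (intro part_finsum_eq) auto
          also have "\<dots> = d h $$ (i, j)"
            using h ij by (auto simp: matrix_ring_simps)
          finally show "d h $$ (i, j) = ?c h $$ (i, j)"
            using h ij by simp
        qed
      qed
    qed
  next
    case (3 g h M N)
    then show ?case
      using mat_set_index[OF 3(3)] mat_set_index[OF 3(4)]
      by (auto simp: matrix_ring_simps mat_mem_mat_set intro!: comp_finsum comp_mult)
  qed
  then show ?thesis
    by (intro graded.intro G.group_axioms)
qed

end

section \<open>Scalar matrices as the elements \<epsilon> of the matrix ring\<close>

context eps_graded
begin

lemma scalar_matrix_closed:
  "\<lbrakk>x \<in> Bc g; g \<in> carrier G\<rbrakk> \<Longrightarrow> scalar_matrix n B x \<in> mat_set n (Bc g)"
  by (simp add: scalar_matrix_def mat_mem_mat_set comp_zero)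

text \<open>Passing to scalar matrices respects sums, and products of homogeneous elements. Hence an
  expression of \<open>\<epsilon> g\<close> by products from degrees \<open>g\<close> and
  \<open>g\<acute>\<close> carries over to the scalar matrix.\<close>

lemma eps_graded_matrix_ring:
  "eps_graded G (matrix_ring n B) (\<lambda>g. mat_set n (Bc g)) (\<lambda>g. scalar_matrix n B (\<epsilon> g))"
proof (rule eps_graded.intro[OF graded_matrix_ring], rule eps_graded_axioms.intro,
    unfold epsilon_family_def, intro ballI conjI)
    fix g assume g: "g \<in> carrier G"
    have g': "g\<acute> \<in> carrier G" using g by simp
    let ?P = "ideal_prod (matrix_ring n B) (mat_set n (Bc g)) (mat_set n (Bc (g\<acute>)))"
    have "\<epsilon> g \<in> {z \<in> carrier B. scalar_matrix n B z \<in> ?P}"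
      using eps_mem[OF g]
    proof (rule ideal_prod_memb)
      fix x y assume x: "x \<in> Bc g" and y: "y \<in> Bc (g\<acute>)"
      have xy: "x \<in> carrier B" "y \<in> carrier B"
        using comp_carrier x y g g' by blast+
      have sm: "scalar_matrix n B x \<in> mat_set n (Bc g)" "scalar_matrix n B y \<in> mat_set n (Bc (g\<acute>))"
        using x y g g' scalar_matrix_closed by blast+
      have "scalar_matrix n B (x \<otimes> y) = scalar_matrix n B x \<otimes>\<^bsub>matrix_ring n B\<^esub> scalar_matrix n B y"
      proof (rule mat_set_eqI)
        show "scalar_matrix n B (x \<otimes> y) \<in> mat_set n (carrier B)"
          using xy by (simp add: scalar_matrix_def mat_mem_mat_set)
        show "scalar_matrix n B x \<otimes>\<^bsub>matrix_ring n B\<^esub> scalar_matrix n B y \<in> mat_set n (carrier B)"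
          using sm mat_comp_carrier g g' by (intro matrix_mult_closed) auto
        fix i j assume ij: "i < n" "j < n"
        then show "scalar_matrix n B (x \<otimes> y) $$ (i, j) =
            (scalar_matrix n B x \<otimes>\<^bsub>matrix_ring n B\<^esub> scalar_matrix n B y) $$ (i, j)"
          using xy scalar_matrix_mult_left[OF mat_comp_carrier[OF sm(2) g'] xy(1) ij]
          by (simp add: scalar_matrix_def)
      qed
      then show "x \<otimes> y \<in> {z \<in> carrier B. scalar_matrix n B z \<in> ?P}"
        using xy sm by (auto intro: ideal_prod.prod)
    next
      fix v w assume "v \<in> {z \<in> carrier B. scalar_matrix n B z \<in> ?P}" "w \<in> {z \<in> carrier B. scalar_matrix n B z \<in> ?P}"
      moreover have "scalar_matrix n B (v \<oplus> w) = scalar_matrix n B v \<oplus>\<^bsub>matrix_ring n B\<^esub> scalar_matrix n B w"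
        by (rule eq_matI) (auto simp: scalar_matrix_def matrix_ring_simps)
      ultimately show "v \<oplus> w \<in> {z \<in> carrier B. scalar_matrix n B z \<in> ?P}"
        by (auto intro: ideal_prod.sum)
    qed
    then show "scalar_matrix n B (\<epsilon> g) \<in> ?P" by simp
    fix M assume M: "M \<in> mat_set n (Bc g)"
    note M' = mat_comp_carrier[OF M g]
    have ec: "scalar_matrix n B (\<epsilon> h) \<in> mat_set n (carrier B)" if "h \<in> carrier G" for h
      using that by (simp add: scalar_matrix_def mat_mem_mat_set)
    show "scalar_matrix n B (\<epsilon> g) \<otimes>\<^bsub>matrix_ring n B\<^esub> M = M"
      by (rule mat_set_eqI[OF matrix_mult_closed[OF ec[OF g] M'] M])
        (use g M' mat_set_index[OF M] in \<open>auto simp: scalar_matrix_mult_left eps_l\<close>)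
    show "M \<otimes>\<^bsub>matrix_ring n B\<^esub> scalar_matrix n B (\<epsilon> (g\<acute>)) = M"
      by (rule mat_set_eqI[OF matrix_mult_closed[OF M' ec[OF g']] M])
        (use g' M' mat_set_index[OF M] g in \<open>auto simp: scalar_matrix_mult_right eps_r\<close>)
qed

lemma eps_graded_base_matrix_ring:
  "eps_graded_base G (matrix_ring n B) (\<lambda>g. mat_set n (Bc g)) (\<lambda>g. scalar_matrix n B (\<epsilon> g))
    (matrix_ring n (B\<lparr>carrier := Bc \<e>\<rparr>))"
proof -
  \<comment> \<open>The situation for the entries: it yields that sums of entries formed in the
    degree-one component agree with sums formed in \<open>B\<close>.\<close>
  interpret R: eps_graded_base G B Bc \<epsilon> "B\<lparr>carrier := Bc \<e>\<rparr>"
    by unfold_locales auto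
  show ?thesis
  proof (rule eps_graded_base.intro[OF eps_graded_matrix_ring], rule eps_graded_base_axioms.intro, goal_cases)
    case (2 M N)
    have "finsum (B\<lparr>carrier := Bc \<e>\<rparr>) (\<lambda>k. M $$ (i, k) \<otimes> N $$ (k, j)) {..<n} =
        (\<Oplus>k\<in>{..<n}. M $$ (i, k) \<otimes> N $$ (k, j))" if "i < n" "j < n" for i j
      using that 2 by (intro R.finsum_base) (auto simp: mat_set_index)
    then show ?case
      by (intro eq_matI) (auto simp: matrix_ring_simps)
  qed (auto simp: matrix_ring_simps)
qed

end


section \<open>The equivalences\<close>

lemma is_partial_crossed_product_if_crossed:
  fixes S :: "'b ring"
  assumes "crossed G B Bc \<epsilon> S a b"
  shows "is_partial_crossed_product G B Bc"
  using crossed.unital_twisted_partial_action[OF assms] crossed.partial_crossed_product_iso[OF assms]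
  unfolding is_partial_crossed_product_def by blast

context eps_graded_base
begin

text \<open>The inverse pairs belong to the family \<open>\<epsilon>'\<close> supplied by the
  definition. Instead of identifying it with \<open>\<epsilon>\<close>, the setting is instantiated
  anew with \<open>\<epsilon>'\<close>.\<close>

lemma crossed_if_epsilon_crossed_product:
  assumes "epsilon_crossed_product G B Bc"
  shows "\<exists>\<epsilon>' a b. crossed G B Bc \<epsilon>' S a b"
proof -
  obtain \<epsilon>' where \<epsilon>': "epsilon_family G B Bc \<epsilon>'" and
    inv: "\<And>g. g \<in> carrier G \<Longrightarrow> \<exists>a\<in>Bc g. \<exists>b\<in>Bc (g\<acute>). a \<otimes> b = \<epsilon>' g \<and> b \<otimes> a = \<epsilon>' (g\<acute>)"
    using assms unfolding epsilon_crossed_product_def by blast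
  interpret E': eps_graded_base G B Bc \<epsilon>' S
    by unfold_locales (use \<epsilon>' in auto)
  show ?thesis
    using E'.crossed_exists[OF inv] by blast
qed

lemma generators_if_twisted_bimodules:
  assumes "\<nu> \<in> carrier G \<rightarrow> Iu S"
    and "\<And>g. g \<in> carrier G \<Longrightarrow> bimodule_iso S (sub_bimodule B (Bc g)) (twisted_bimodule S (\<nu> g)) \<noteq> {}"
  obtains \<kappa> where "\<And>g. g \<in> carrier G \<Longrightarrow> \<kappa> g \<in> Bc g \<and>
    ideal_prod B (carrier S) {\<kappa> g} = Bc g \<and> Bc g = ideal_prod B {\<kappa> g} (carrier S)"
proof -
  have "\<forall>g. \<exists>k. g \<in> carrier G \<longrightarrow> k \<in> Bc g \<and>
      ideal_prod B (carrier S) {k} = Bc g \<and> Bc g = ideal_prod B {k} (carrier S)"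
    using generator_if_twisted_bimodule assms by (metis PiE)
  then show thesis
    using that by metis
qed

lemma epsilon_crossed_product_if_generators:
  assumes "\<And>g. g \<in> carrier G \<Longrightarrow> \<kappa> g \<in> Bc g \<and>
    ideal_prod B (carrier S) {\<kappa> g} = Bc g \<and> Bc g = ideal_prod B {\<kappa> g} (carrier S)"
  shows "epsilon_crossed_product G B Bc"
proof -
  have "\<exists>a\<in>Bc g. \<exists>b\<in>Bc (g\<acute>). a \<otimes> b = \<epsilon> g \<and> b \<otimes> a = \<epsilon> (g\<acute>)" if "g \<in> carrier G" for g
    using assms[OF that] by (intro bexI[of _ "\<kappa> g"] generator_epsilon_invertible[OF that]) auto
  then show ?thesis
    unfolding epsilon_crossed_product_def using graded_ring_axioms eps by blast
qed

text \<open>Makes a generator of a non-zero component an admissible value of a map into the non-zero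
  homogeneous elements.\<close>

lemma generator_nonzero:
  assumes "ideal_prod B (carrier S) {k} = Bc g" "x \<in> Bc g" "x \<noteq> \<zero>"
  shows "k \<noteq> \<zero>"
proof
  assume "k = \<zero>"
  then have "x \<in> {s \<otimes> \<zero> |s. s \<in> Bc \<e>}"
    using assms(1,2) ideal_prod_base_singleton[OF zero_closed] by simp
  then show False
    using assms(3) by auto
qed

end

text \<open>A zero component has no generator but zero, which is not in \<open>H\<close>. Assertion
  (iv) is therefore a predicate of the set of allowed values: zero is adjoined in general, where it
  can be chosen only for a zero component, and the set of non-zero homogeneous elements itself is
  used when all components are non-zero.\<close>

theorem theorem4p2:
  fixes G :: "('g, 'k) monoid_scheme"
    and A :: "('a, 'm) ring_scheme" and Ac :: "'g \<Rightarrow> 'a set"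
    and R :: "('a, 'm) ring_scheme" and n :: nat
  assumes "epsilon_strongly_graded G A Ac"
    and "R = A\<lparr>carrier := Ac \<one>\<^bsub>G\<^esub>\<rparr>"
    and "n > 0"
  defines "B \<equiv> matrix_ring n A"
    and "Bc \<equiv> (\<lambda>g. mat_set n (Ac g))"
    and "S \<equiv> matrix_ring n R"
  defines "i \<equiv> is_partial_crossed_product G B Bc"
    and "ii \<equiv> epsilon_crossed_product G B Bc"
    and "iii \<equiv> (\<exists>\<nu> \<in> carrier G \<rightarrow> Iu S. \<forall>g\<in>carrier G.
           bimodule_iso S (sub_bimodule B (Bc g)) (twisted_bimodule S (\<nu> g)) \<noteq> {})"
    and "iv \<equiv> (\<lambda>H. \<exists>\<kappa> \<in> carrier G \<rightarrow> H. \<forall>g\<in>carrier G.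
           \<kappa> g \<in> Bc g \<and>
           ideal_prod B (carrier S) {\<kappa> g} = Bc g \<and> Bc g = ideal_prod B {\<kappa> g} (carrier S))"
  shows "(i \<longleftrightarrow> ii) \<and> (ii \<longleftrightarrow> iii) \<and>
    (iii \<longleftrightarrow> iv (nonzero_homogeneous G B Bc \<union> {\<zero>\<^bsub>B\<^esub>})) \<and>
    ((\<forall>g\<in>carrier G. Ac g \<noteq> {\<zero>\<^bsub>A\<^esub>}) \<longrightarrow> (iii \<longleftrightarrow> iv (nonzero_homogeneous G B Bc)))"
proof -
  let ?H = "nonzero_homogeneous G B Bc"
  obtain \<epsilon> where "graded_ring G A Ac" and \<epsilon>: "epsilon_family G A Ac \<epsilon>"
    using assms(1) unfolding epsilon_strongly_graded_def by blast
  then interpret A: graded_ring G A Ac by blast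
  interpret A: eps_graded G A Ac \<epsilon>
    by unfold_locales (rule \<epsilon>)
  have base: "eps_graded_base G B Bc (\<lambda>g. scalar_matrix n A (\<epsilon> g)) S"
    unfolding B_def Bc_def S_def assms(2) by (rule A.eps_graded_base_matrix_ring)
  note base_facts = eps_graded_base.crossed_if_epsilon_crossed_product[OF base]
    eps_graded_base.generators_if_twisted_bimodules[OF base]
    eps_graded_base.epsilon_crossed_product_if_generators[OF base]
    eps_graded_base.generator_nonzero[OF base]
  have graded: "graded G B Bc"
    unfolding B_def Bc_def by (rule A.graded_matrix_ring)

  have i_ii: ii if i
    using that graded.epsilon_crossed_product_if_partial[OF graded]
    unfolding i_def ii_def is_partial_crossed_product_def by blast
  have ii_i: i if ii
    using base_facts(1) that is_partial_crossed_product_if_crossed unfolding i_def ii_def S_def by blast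
  have ii_iii: iii if ii
  proof -
    obtain \<epsilon>' a b where c: "crossed G B Bc \<epsilon>' S a b"
      using base_facts(1) \<open>ii\<close> unfolding ii_def by blast
    show ?thesis
      unfolding iii_def using crossed.twisted_bimodule_exists[OF c]
      by (intro bexI[of _ "\<lambda>g. (\<epsilon>' (inv\<^bsub>G\<^esub> g), \<epsilon>' g,
        restrict (crossed.act B a b g) (PIdl\<^bsub>S\<^esub> (\<epsilon>' (inv\<^bsub>G\<^esub> g))))"]) auto
  qed
  \<comment> \<open>Keeping \<open>H\<close> arbitrary treats both versions of (iv) at once; only
    the membership of generators in \<open>H\<close> differs.\<close>
  have iii_iv: "iv H" if iii and H: "\<And>g k. \<lbrakk>g \<in> carrier G; k \<in> Bc g; ideal_prod B (carrier S) {k} = Bc g\<rbrakk> \<Longrightarrow> k \<in> H" for H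
  proof -
    obtain \<nu> where \<nu>: "\<nu> \<in> carrier G \<rightarrow> Iu S"
      "\<And>g. g \<in> carrier G \<Longrightarrow> bimodule_iso S (sub_bimodule B (Bc g)) (twisted_bimodule S (\<nu> g)) \<noteq> {}"
      using \<open>iii\<close> unfolding iii_def by blast
    obtain \<kappa> where \<kappa>: "\<And>g. g \<in> carrier G \<Longrightarrow> \<kappa> g \<in> Bc g \<and>
        ideal_prod B (carrier S) {\<kappa> g} = Bc g \<and> Bc g = ideal_prod B {\<kappa> g} (carrier S)"
      using base_facts(2)[OF \<nu>] by blast
    then have "\<kappa> \<in> carrier G \<rightarrow> H"
      using H by blast
    then show ?thesis
      unfolding iv_def using \<kappa> by blast
  qed
  have iv_ii: ii if "iv H" for H
    using base_facts(3) that unfolding ii_def iv_def by blast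
  have mem: "k \<in> ?H \<union> {\<zero>\<^bsub>B\<^esub>}" if "g \<in> carrier G" "k \<in> Bc g" for g k
    using that unfolding nonzero_homogeneous_def by blast
  have nonzero: "k \<in> ?H"
    if nz: "\<forall>g\<in>carrier G. Ac g \<noteq> {\<zero>\<^bsub>A\<^esub>}" and g: "g \<in> carrier G" and k: "k \<in> Bc g"
      and gen: "ideal_prod B (carrier S) {k} = Bc g" for g k
  proof -
    obtain x where x: "x \<in> Ac g" "x \<noteq> \<zero>\<^bsub>A\<^esub>"
      using nz g A.comp_zero[OF g] by blast
    \<comment> \<open>Positivity of \<open>n\<close> provides the entry \<open>(0, 0)\<close>, which
      transfers a non-zero element of \<open>Ac g\<close> to a non-zero matrix of the same
      degree.\<close>
    have "scalar_matrix n A x $$ (0, 0) \<noteq> \<zero>\<^bsub>B\<^esub> $$ (0, 0)"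
      using x(2) assms(3) by (simp add: B_def scalar_matrix_def matrix_ring_simps)
    then have "scalar_matrix n A x \<noteq> \<zero>\<^bsub>B\<^esub>" by metis
    moreover have "scalar_matrix n A x \<in> Bc g"
      unfolding Bc_def by (rule A.scalar_matrix_closed[OF x(1) g])
    ultimately have "k \<noteq> \<zero>\<^bsub>B\<^esub>"
      using base_facts(4)[OF gen] by blast
    then show ?thesis
      using g k unfolding nonzero_homogeneous_def by blast
  qed
  have iii_iv_zero: "iv (?H \<union> {\<zero>\<^bsub>B\<^esub>})" if iii
    using that by (rule iii_iv) (rule mem)
  have "iv ?H" if "\<forall>g\<in>carrier G. Ac g \<noteq> {\<zero>\<^bsub>A\<^esub>}" iii
    using that(2) by (rule iii_iv) (rule nonzero[OF that(1)])
  then have "iii \<longleftrightarrow> iv ?H" if "\<forall>g\<in>carrier G. Ac g \<noteq> {\<zero>\<^bsub>A\<^esub>}"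
    using that iv_ii[of ?H] ii_iii by blast
  moreover have "iii \<longleftrightarrow> iv (?H \<union> {\<zero>\<^bsub>B\<^esub>})"
    using iii_iv_zero iv_ii[of "?H \<union> {\<zero>\<^bsub>B\<^esub>}"] ii_iii by blast
  moreover have "ii \<longleftrightarrow> iii"
    using ii_iii iii_iv_zero iv_ii[of "?H \<union> {\<zero>\<^bsub>B\<^esub>}"] by blast
  ultimately show ?thesis
    using i_ii ii_i by blast
qed

end
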